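(* Let $V$ be a set of $n$ vertices and $U\subseteq V$ with $2\le |U|\le n-1$. Then the clique number of the 1-skeleton of the polytope $SVMST_{n,U}$ satisfies $$\omega(SVMST_{n,U}) \geq 2^{\left(\sqrt{\left\lfloor \frac{n-|U|-1}{2}\right\rfloor}-9\right)/2}.$$
   Context: $K_n$ is the complete graph on $V$ with edge set $E$, $|E|=d=n(n-1)/2$. For a subgraph $t$ of $K_n$, $x(t)\in\mathbb{R}^d$ (coordinates indexed by $E$) is its characteristic vector: coordinate $1$ for edges of $t$, $0$ otherwise. $SVMST_{n,U}$ is the convex hull of the characteristic vectors of all spanning trees of $K_n$ all of whose leaves (vertices of degree $1$) belong to $U$. The 1-skeleton of a polytope is the graph whose vertices are the polytope's vertices and whose edges are its 1-dimensional faces; $\omega(\cdot)$ denotes its clique number (size of a largest clique). *)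

theory Defs
  imports "HOL-Analysis.Analysis"
begin

text \<open>Vertex set V is the whole (finite) type 'v, so n = CARD('v).
  Edges of K_n are the 2-element subsets of V.  A subgraph is given by its edge set.\<close>

definition Kn_edges :: "'v set set" where
  "Kn_edges = {e. card e = 2}"

definition adj_in :: "'v set set \<Rightarrow> 'v \<Rightarrow> 'v \<Rightarrow> bool" where
  "adj_in T u v \<longleftrightarrow> {u, v} \<in> T \<and> u \<noteq> v"

definition connected_graph :: "'v set set \<Rightarrow> bool" where
  "connected_graph T \<longleftrightarrow> (\<forall>u v. (adj_in T)\<^sup>*\<^sup>* u v)"

definition is_cycle :: "'v set set \<Rightarrow> 'v list \<Rightarrow> bool" where
  "is_cycle T cs \<longleftrightarrow> length cs \<ge> 3 \<and> distinct cs \<and>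
     (\<forall>i < length cs. adj_in T (cs ! i) (cs ! ((i + 1) mod length cs)))"

definition acyclic_graph :: "'v set set \<Rightarrow> bool" where
  "acyclic_graph T \<longleftrightarrow> (\<nexists>cs. is_cycle T cs)"

definition spanning_tree :: "'v set set \<Rightarrow> bool" where
  "spanning_tree T \<longleftrightarrow> T \<subseteq> Kn_edges \<and> connected_graph T \<and> acyclic_graph T"

definition degree :: "'v set set \<Rightarrow> 'v \<Rightarrow> nat" where
  "degree T v = card {e \<in> T. v \<in> e}"

definition leaves :: "'v set set \<Rightarrow> 'v set" where
  "leaves T = {v. degree T v = 1}"

text \<open>Characteristic vector in R^E; coordinates are indexed by all subsets of V,
  those not in E being identically 0 (isometric copy of R^E).\<close>
definition char_vec :: "'v set set \<Rightarrow> real ^ ('v::finite set)" where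
  "char_vec T = (\<chi> e. if e \<in> T \<and> e \<in> Kn_edges then 1 else 0)"

definition SVMST :: "'v::finite set \<Rightarrow> (real ^ ('v set)) set" where
  "SVMST U = convex hull {char_vec T | T. spanning_tree T \<and> leaves T \<subseteq> U}"

definition poly_vertices :: "'a::euclidean_space set \<Rightarrow> 'a set" where
  "poly_vertices P = {x. x extreme_point_of P}"

definition skel_adj :: "'a::euclidean_space set \<Rightarrow> 'a \<Rightarrow> 'a \<Rightarrow> bool" where
  "skel_adj P u v \<longleftrightarrow> u \<in> poly_vertices P \<and> v \<in> poly_vertices P \<and> u \<noteq> v \<and>
     (\<exists>F. F face_of P \<and> aff_dim F = 1 \<and> u \<in> F \<and> v \<in> F)"

definition skel_clique :: "'a::euclidean_space set \<Rightarrow> 'a set \<Rightarrow> bool" where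
  "skel_clique P K \<longleftrightarrow> K \<subseteq> poly_vertices P \<and> (\<forall>u\<in>K. \<forall>v\<in>K. u \<noteq> v \<longrightarrow> skel_adj P u v)"

definition clique_number :: "'a::euclidean_space set \<Rightarrow> nat" where
  "clique_number P = Sup {card K | K. finite K \<and> skel_clique P K}"

end

theory Submission
  imports Defs
begin

text \<open>
  All trees used are Hamiltonian paths whose two ends lie in \<open>U\<close>.  Every tree of the family
  satisfies \<open>deg v \<ge> 2\<close> off \<open>U\<close>, so equality here cuts out a face, and two such paths \<open>x\<close>, \<open>y\<close> are
  adjacent as soon as no third one \<open>z\<close> satisfies \<open>x \<inter> y \<subseteq> z \<subseteq> x \<union> y\<close>.

  The \<open>2 ^ k\<close> paths \<open>P\<^sub>x\<close>, \<open>x \<in> {0, 1} ^ k\<close>, run through a \<open>k \<times> k\<close> matrix of cells, row by row, and the bit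
  \<open>x\<^sub>i\<close> decides in which direction the fixed edges \<open>l r\<close> of row \<open>i\<close> are traversed: state 0 links
  \<open>r\<close> to the next \<open>l\<close>, state 1 links \<open>l\<close> to the next \<open>r\<close>.  For \<open>i < j\<close> there is an additional fixed edge, the
  token, which is visited inside cell \<open>(i, j)\<close> if \<open>x\<^sub>i = 0\<close> and inside cell \<open>(j, i)\<close> if \<open>x\<^sub>i = 1\<close>.
  If \<open>x\<close> and \<open>y\<close> differ in both \<open>i\<close> and \<open>j\<close>, then a path \<open>z\<close> between them that follows \<open>x\<close> in row \<open>i\<close> and
  \<open>y\<close> in row \<open>j\<close> would visit the token twice or not at all; hence \<open>z\<close> follows \<open>x\<close> in all rows or
  \<open>y\<close> in all rows.  That \<open>z\<close> cannot change its state inside a row is forced by the degrees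
  together with the exclusion of closed 4-cycles \<open>l r l' r'\<close>.
\<close>

section \<open>Adjacency in the polytope\<close>

lemma char_vec_inner:
  fixes T :: "'v::finite set set"
  assumes "T \<subseteq> Kn_edges"
  shows "(\<chi> e. c e) \<bullet> char_vec T = (\<Sum>e\<in>T. c e)"
proof -
  have "(\<chi> e. c e) \<bullet> char_vec T = (\<Sum>e\<in>UNIV. if e \<in> T then c e else 0)"
    using assms by (auto simp: inner_vec_def char_vec_def intro!: sum.cong)
  then show ?thesis by (simp add: sum.If_cases)
qed

lemma char_vec_inj:
  assumes "T \<subseteq> Kn_edges" "T' \<subseteq> Kn_edges" "char_vec T = char_vec T'"
  shows "T = T'"
proof -
  have "e \<in> T \<longleftrightarrow> e \<in> T'" for e
    using arg_cong[OF assms(3), of "\<lambda>v. v $ e"] assms(1,2)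
    by (auto simp: char_vec_def split: if_splits)
  then show ?thesis by blast
qed

text \<open>Once \<open>U\<close> is nonempty, every tree of the family has degree at least 2 at
  each vertex off \<open>U\<close>; the tight trees are those for which all these inequalities are
  equalities.\<close>

definition tight :: "'v::finite set \<Rightarrow> 'v set set \<Rightarrow> bool" where
  "tight U T \<longleftrightarrow> spanning_tree T \<and> leaves T \<subseteq> U \<and> (\<forall>v. v \<notin> U \<longrightarrow> degree T v = 2)"

lemma degree_ge_2:
  fixes T :: "'v::finite set set"
  assumes T: "spanning_tree T" "leaves T \<subseteq> U" and v: "v \<notin> U" and w: "w \<noteq> v"
  shows "degree T v \<ge> 2"
proof -
  have "(adj_in T)\<^sup>*\<^sup>* v w" using T by (simp add: spanning_tree_def connected_graph_def)
  then obtain u where "adj_in T v u" using w by (metis converse_rtranclpE)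
  then have "{v, u} \<in> {e \<in> T. v \<in> e}" by (simp add: adj_in_def)
  then have "degree T v \<noteq> 0" unfolding degree_def by (auto simp: card_eq_0_iff)
  moreover have "degree T v \<noteq> 1" using T(2) v by (auto simp: leaves_def)
  ultimately show ?thesis by linarith
qed

lemma segment_face_SVMST:
  fixes x y :: "'v::finite set set"
  assumes x: "tight U x" and y: "tight U y" and U: "2 \<le> card U"
    and only: "\<And>z. tight U z \<Longrightarrow> x \<inter> y \<subseteq> z \<Longrightarrow> z \<subseteq> x \<union> y \<Longrightarrow> z = x \<or> z = y"
  shows "convex hull {char_vec x, char_vec y} face_of SVMST U"
proof -
  define X where "X = {T :: 'v set set. spanning_tree T \<and> leaves T \<subseteq> U}"
  have SV: "SVMST U = convex hull (char_vec ` X)"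
    unfolding SVMST_def X_def by (rule arg_cong[where f="\<lambda>A. convex hull A"]) auto
  have xX: "x \<in> X" "y \<in> X" using x y by (auto simp: tight_def X_def)
  have XK: "T \<subseteq> Kn_edges" if "T \<in> X" for T using that by (auto simp: X_def spanning_tree_def)
  \<comment> \<open>The functional rewards common edges, punishes edges outside the union and
    charges each edge once per end off \<open>U\<close>, so that a tree pays its total degree there.
    The three contributions are bounded separately, so reaching \<open>B\<close> forces equality in
    all three.\<close>
  define c where "c e = (if e \<in> x \<inter> y then 1 else 0) - (if e \<notin> x \<union> y then 1 else 0)
      - (\<Sum>v\<in>-U. if v \<in> e then 1 else (0::real))" for e
  define B where "B = real (card (x \<inter> y)) - 2 * real (card (-U))"
  have val: "(\<chi> e. c e) \<bullet> char_vec T = real (card (T \<inter> (x \<inter> y))) - real (card (T - (x \<union> y)))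
      - (\<Sum>v\<in>-U. real (degree T v))" if "T \<in> X" for T
  proof -
    have "(\<Sum>e\<in>T. \<Sum>v\<in>-U. if v \<in> e then 1 else (0::real)) = (\<Sum>v\<in>-U. real (degree T v))"
      by (subst sum.swap) (simp add: degree_def sum.If_cases Int_def)
    moreover have "(\<Sum>e\<in>T. if e \<in> x \<inter> y then 1 else (0::real)) = real (card (T \<inter> (x \<inter> y)))"
      by (simp add: sum.If_cases Int_def)
    moreover have "(\<Sum>e\<in>T. if e \<notin> x \<union> y then 1 else (0::real)) = real (card (T - (x \<union> y)))"
      by (simp add: sum.If_cases Int_def Diff_eq Compl_eq)
    ultimately show ?thesis
      unfolding char_vec_inner[OF XK[OF that]] c_def by (simp add: sum_subtractf)
  qed
  have deg: "2 \<le> degree T v" if "T \<in> X" "v \<in> -U" for T v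
  proof -
    obtain w where "w \<in> U" using U by fastforce
    then show ?thesis using that degree_ge_2[of T U v w] by (auto simp: X_def)
  qed
  have degsum: "2 * real (card (-U)) \<le> (\<Sum>v\<in>-U. real (degree T v))" if "T \<in> X" for T
    using sum_mono[of "-U" "\<lambda>_. 2" "\<lambda>v. real (degree T v)"] deg[OF that] by (simp add: mult.commute)
  have cap: "card (T \<inter> (x \<inter> y)) \<le> card (x \<inter> y)" for T
    by (rule card_mono) auto
  have le: "(\<chi> e. c e) \<bullet> char_vec T \<le> B" if "T \<in> X" for T
    using val[OF that] degsum[OF that] cap[of T] unfolding B_def by linarith
  have eqD: "T = x \<or> T = y" if T: "T \<in> X" and eq: "(\<chi> e. c e) \<bullet> char_vec T = B" for T
  proof (rule only)
    have *: "card (T \<inter> (x \<inter> y)) = card (x \<inter> y)" "card (T - (x \<union> y)) = 0"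
      "(\<Sum>v\<in>-U. real (degree T v)) = 2 * real (card (-U))"
      using val[OF T] degsum[OF T] cap[of T] eq unfolding B_def by linarith+
    have "T \<inter> (x \<inter> y) = x \<inter> y" using *(1) by (intro card_subset_eq) auto
    then show "x \<inter> y \<subseteq> T" by blast
    show "T \<subseteq> x \<union> y" using *(2) by simp
    have "(\<Sum>v\<in>-U. real (degree T v) - 2) = 0" using *(3) by (simp add: sum_subtractf)
    then have "\<forall>v\<in>-U. real (degree T v) - 2 = 0"
      using deg[OF T] by (subst (asm) sum_nonneg_eq_0_iff) auto
    then show "tight U T" using T by (auto simp: tight_def X_def)
  qed
  have eqI: "(\<chi> e. c e) \<bullet> char_vec x = B" "(\<chi> e. c e) \<bullet> char_vec y = B"
  proof -
    have "(\<Sum>v\<in>-U. real (degree x v)) = (\<Sum>v\<in>-U. 2)" "(\<Sum>v\<in>-U. real (degree y v)) = (\<Sum>v\<in>-U. 2)"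
      using x y by (auto simp: tight_def intro!: sum.cong)
    moreover have "x \<inter> (x \<inter> y) = x \<inter> y" "y \<inter> (x \<inter> y) = x \<inter> y"
      "x - (x \<union> y) = {}" "y - (x \<union> y) = {}" by blast+
    ultimately show "(\<chi> e. c e) \<bullet> char_vec x = B" "(\<chi> e. c e) \<bullet> char_vec y = B"
      using val[OF xX(1)] val[OF xX(2)] by (simp_all add: B_def)
  qed
  define F where "F = SVMST U \<inter> {p. (\<chi> e. c e) \<bullet> p = B}"
  have "(\<chi> e. c e) \<bullet> p \<le> B" if "p \<in> SVMST U" for p
  proof -
    have "SVMST U \<subseteq> {p. (\<chi> e. c e) \<bullet> p \<le> B}"
      unfolding SV by (rule hull_minimal) (use le in \<open>auto simp: convex_halfspace_le\<close>)
    then show ?thesis using that by blast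
  qed
  then have face: "F face_of SVMST U"
    unfolding F_def by (intro face_of_Int_supporting_hyperplane_le) (simp_all add: SV)
  have "compact (char_vec ` X)" by (simp add: finite_imp_compact)
  \<comment> \<open>A face of a hull of finitely many points is the hull of some of them, so it
    remains to see which generators lie on the hyperplane.\<close>
  then obtain s where s: "s \<subseteq> char_vec ` X" "F = convex hull s"
    using face face_of_convex_hull_subset unfolding SV by metis
  have "s \<subseteq> {char_vec x, char_vec y}"
  proof
    fix p assume p: "p \<in> s"
    then obtain T where T: "T \<in> X" "p = char_vec T" using s by auto
    have "p \<in> F" using p s(2) by (simp add: hull_inc)
    then show "p \<in> {char_vec x, char_vec y}" using eqD[OF T(1)] T(2) by (auto simp: F_def)
  qed
  then have "F \<subseteq> convex hull {char_vec x, char_vec y}" unfolding s(2) by (rule hull_mono)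
  moreover have "convex hull {char_vec x, char_vec y} \<subseteq> F"
  proof (rule hull_minimal)
    show "convex F" using face face_of_imp_convex by blast
    show "{char_vec x, char_vec y} \<subseteq> F"
      using eqI xX by (auto simp: F_def SV hull_inc)
  qed
  ultimately show ?thesis using face by auto
qed

lemma clique_number_SVMST_ge:
  fixes \<T> :: "'v::finite set set set"
  assumes U: "2 \<le> card U" and tight: "\<And>x. x \<in> \<T> \<Longrightarrow> tight U x"
    and only: "\<And>x y z. x \<in> \<T> \<Longrightarrow> y \<in> \<T> \<Longrightarrow> x \<noteq> y \<Longrightarrow> tight U z \<Longrightarrow>
      x \<inter> y \<subseteq> z \<Longrightarrow> z \<subseteq> x \<union> y \<Longrightarrow> z = x \<or> z = y"
  shows "card \<T> \<le> clique_number (SVMST U)"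
proof -
  let ?P = "SVMST U"
  have inj: "inj_on char_vec \<T>"
    by (intro inj_onI char_vec_inj) (use tight in \<open>auto simp: tight_def spanning_tree_def\<close>)
  have vert: "char_vec x \<in> poly_vertices ?P" if "x \<in> \<T>" for x
  proof -
    \<comment> \<open>Vertices are the degenerate case of equal ends: only \<open>x\<close> itself
      lies between \<open>x\<close> and \<open>x\<close>.\<close>
    have "convex hull {char_vec x, char_vec x} face_of ?P"
      using tight[OF that] U by (intro segment_face_SVMST) auto
    then show ?thesis by (simp add: poly_vertices_def face_of_singleton)
  qed
  have "skel_clique ?P (char_vec ` \<T>)"
    unfolding skel_clique_def
  proof (intro conjI ballI impI)
    show "char_vec ` \<T> \<subseteq> poly_vertices ?P" using vert by auto
    fix u v assume "u \<in> char_vec ` \<T>" "v \<in> char_vec ` \<T>" and ne: "u \<noteq> v"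
    then obtain x y where xy: "x \<in> \<T>" "y \<in> \<T>" "u = char_vec x" "v = char_vec y" by auto
    have "convex hull {u, v} face_of ?P"
      using tight xy U only[OF xy(1,2)] ne unfolding xy(3,4) by (intro segment_face_SVMST) auto
    moreover have "aff_dim (convex hull {u, v}) = 1"
      using ne by (simp add: aff_dim_convex_hull)
    ultimately show "skel_adj ?P u v"
      unfolding skel_adj_def using vert xy ne by (auto intro!: exI[of _ "convex hull {u, v}"] simp: hull_inc)
  qed
  then have mem: "card (char_vec ` \<T>) \<in> {card K | K. finite K \<and> skel_clique ?P K}" by auto
  \<comment> \<open>A \<open>Sup\<close> of naturals dominates its members only if they are bounded;
    the number of vertices bounds every clique.\<close>
  have "finite (poly_vertices ?P)"
  proof (rule finite_subset)
    show "poly_vertices ?P \<subseteq> char_vec ` {T. spanning_tree T \<and> leaves T \<subseteq> U}"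
      unfolding poly_vertices_def SVMST_def using extreme_point_of_convex_hull by blast
  qed auto
  then have "bdd_above {card K | K. finite K \<and> skel_clique ?P K}"
    by (intro bdd_aboveI[of _ "card (poly_vertices ?P)"]) (auto simp: skel_clique_def intro: card_mono)
  then have "card (char_vec ` \<T>) \<le> clique_number ?P"
    unfolding clique_number_def using mem by (intro cSup_upper)
  then show ?thesis using inj by (simp add: card_image)
qed

section \<open>Connected graphs of small degree\<close>

lemma connected_graph_closed:
  assumes "connected_graph T" "v \<in> X" and closed: "\<And>u w. u \<in> X \<Longrightarrow> adj_in T u w \<Longrightarrow> w \<in> X"
  shows "X = UNIV"
proof -
  have "w \<in> X" for w
  proof -
    have "(adj_in T)\<^sup>*\<^sup>* v w" using assms by (simp add: connected_graph_def)
    then show ?thesis by (induction rule: rtranclp_induct) (use assms in auto)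
  qed
  then show ?thesis by auto
qed

lemma edges_at_eqI:
  fixes T :: "'v::finite set set"
  assumes "degree T v \<le> 2" "e \<in> T" "e' \<in> T" "v \<in> e" "v \<in> e'" "e \<noteq> e'"
  shows "{e \<in> T. v \<in> e} = {e, e'}"
  using assms by (intro card_seteq[symmetric]) (auto simp: degree_def)

text \<open>Each vertex of a cycle spends both its edges on the cycle, so the cycle is closed under
  adjacency and by connectivity passes through \<open>a\<close>, which has too few edges.\<close>

lemma acyclic_graphI:
  fixes T :: "'v::finite set set"
  assumes conn: "connected_graph T" and deg: "\<And>v. degree T v \<le> 2" and a: "degree T a \<le> 1"
  shows "acyclic_graph T"
  unfolding acyclic_graph_def
proof
  assume "\<exists>cs. is_cycle T cs"
  then obtain cs where cs: "is_cycle T cs" by blast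
  define n where "n = length cs"
  have n: "n \<ge> 3" and dist: "distinct cs"
    and adj: "\<And>i. i < n \<Longrightarrow> adj_in T (cs ! i) (cs ! ((i + 1) mod n))"
    using cs by (auto simp: is_cycle_def n_def)
  have two: "\<exists>u w. u \<in> set cs \<and> w \<in> set cs \<and> {v, u} \<noteq> {v, w} \<and> {v, u} \<in> T \<and> {v, w} \<in> T"
    if v: "v \<in> set cs" for v
  proof -
    obtain i where i: "i < n" "v = cs ! i" using v by (auto simp: n_def in_set_conv_nth)
    define s where "s = (i + 1) mod n"
    \<comment> \<open>Cyclic predecessor; it differs from the successor because the length is at
      least 3.\<close>
    define r where "r = (if i = 0 then n - 1 else i - 1)"
    have rs: "r < n" "s < n" "r \<noteq> s" using i n by (auto simp: r_def s_def mod_Suc)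
    have r1: "(r + 1) mod n = i" using i n by (auto simp: r_def)
    have "{v, cs ! r} \<in> T" using adj[OF rs(1)] i r1 by (simp add: adj_in_def insert_commute)
    moreover have "{v, cs ! s} \<in> T" using adj[OF i(1)] i by (simp add: adj_in_def s_def)
    moreover have "cs ! r \<noteq> cs ! s" using rs dist by (simp add: nth_eq_iff_index_eq n_def)
    ultimately show ?thesis using rs by (intro exI[of _ "cs ! r"] exI[of _ "cs ! s"])
        (auto simp: n_def doubleton_eq_iff)
  qed
  have "set cs = UNIV"
  proof (rule connected_graph_closed[OF conn])
    show "cs ! 0 \<in> set cs" using n by (intro nth_mem) (auto simp: n_def)
    fix v w assume v: "v \<in> set cs" and vw: "adj_in T v w"
    obtain u u' where u: "u \<in> set cs" "u' \<in> set cs" "{v, u} \<noteq> {v, u'}" "{v, u} \<in> T" "{v, u'} \<in> T"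
      using two[OF v] by blast
    have "{e \<in> T. v \<in> e} = {{v, u}, {v, u'}}" by (rule edges_at_eqI[OF deg u(4,5) _ _ u(3)]) simp_all
    moreover have "{v, w} \<in> {e \<in> T. v \<in> e}" using vw by (simp add: adj_in_def)
    ultimately have "{v, w} = {v, u} \<or> {v, w} = {v, u'}" by (metis insertE singletonD)
    then show "w \<in> set cs" using u v by (auto simp: doubleton_eq_iff)
  qed
  then have "a \<in> set cs" by simp
  from two[OF this] obtain u u' where u: "{a, u} \<noteq> {a, u'}" "{a, u} \<in> T" "{a, u'} \<in> T" by metis
  have "card {{a, u}, {a, u'}} \<le> card {e \<in> T. a \<in> e}" using u(2,3) by (intro card_mono) simp_all
  moreover have "card {{a, u}, {a, u'}} = 2" using u(1) by (subst card_2_iff) blast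
  ultimately show False using a by (simp add: degree_def)
qed

section \<open>Cells and their switchings\<close>

fun flip :: "nat \<times> nat \<Rightarrow> nat \<times> nat" where
  "flip (q, p) = (q, if even p then Suc p else p - 1)"

lemma less_8_cases:
  assumes "p < (8::nat)"
  obtains "p = 0" | "p = 1" | "p = 2" | "p = 3" | "p = 4" | "p = 5" | "p = 6" | "p = 7"
  using assms by linarith

text \<open>
  Cells are numbered \<open>0, \<dots>, K - 1\<close> along the path, \<open>pr\<close> is transposition, and \<open>q < pr q\<close> says that \<open>q\<close> lies
  above the diagonal.  Vertex \<open>(q, p)\<close> is the \<open>p\<close>-th vertex of cell \<open>q\<close>; the fixed edges are
  \<open>0 1\<close>, \<open>2 3\<close>, \<open>4 5\<close>, \<open>6 7\<close>, with the even ends in the role of \<open>l\<close>.  Above the diagonal, \<open>6 7\<close> is the token.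
  The path enters the first cell from \<open>(K, 1)\<close> and leaves the last one to \<open>(K, 0)\<close>.
\<close>

locale cells =
  fixes K :: nat and pr :: "nat \<Rightarrow> nat"
  assumes pr_less: "q < K \<Longrightarrow> pr q < K"
    and pr_pr: "q < K \<Longrightarrow> pr (pr q) = q"
begin

definition cell_vertices :: "(nat \<times> nat) set" where
  "cell_vertices = {..<K} \<times> {..<8}"

definition switch_vertices :: "(nat \<times> nat) set" where
  "switch_vertices = insert (K, 0) (insert (K, 1) cell_vertices)"

text \<open>The guard makes \<open>entry b K\<close> the sink \<open>(K, 0)\<close> whatever
  \<open>b K\<close> is, so the last cell needs no separate formula for its outgoing link.\<close>

definition entry :: "(nat \<Rightarrow> bool) \<Rightarrow> nat \<Rightarrow> nat \<times> nat" where
  "entry b q = (q, if q < K \<and> b q then 1 else 0)"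

definition exit :: "(nat \<Rightarrow> bool) \<Rightarrow> nat \<Rightarrow> nat \<times> nat" where
  "exit b q = (q, if q < pr q then (if b q then 4 else 5) else (if b q then 6 else 7))"

definition before :: "(nat \<Rightarrow> bool) \<Rightarrow> nat \<Rightarrow> nat \<times> nat" where
  "before b q = (if q = 0 then (K, 1) else exit b (q - 1))"

text \<open>In state 1 an upper cell hands its token to its transpose. Diagonal cells fail the
  strict inequality and host nothing.\<close>

definition hosts :: "(nat \<Rightarrow> bool) \<Rightarrow> nat \<Rightarrow> bool" where
  "hosts b q \<longleftrightarrow> pr q < q \<and> b (pr q)"

text \<open>The lists encode these traversals. Upper cell: \<open>0 1 2 3 6 7 4 5\<close> in state
  0, \<open>1 0 3 2 5 4\<close> in state 1. Other cells: \<open>0 1 2 3 4 5 6 7\<close> in state 0,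
  \<open>1 0 3 2 5 4 7 6\<close> in state 1, where a hosted token is inserted between
  \<open>3\<close> and \<open>4\<close>, respectively between \<open>4\<close> and \<open>7\<close>.
  The two places differ so that the links \<open>5 6\<close> of state 0 and \<open>2 5\<close> of
  state 1 are never interrupted.\<close>

definition inner_mate :: "(nat \<Rightarrow> bool) \<Rightarrow> nat \<Rightarrow> nat \<Rightarrow> nat \<times> nat" where
  "inner_mate b q p =
    (if q < pr q then
       if b q then
         [(q, 3), before b q, (q, 5), (q, 0), entry b (Suc q), (q, 2),
          (pr q, if b (pr q) then 7 else 3), (pr q, 4)] ! p
       else
         [before b q, (q, 2), (q, 1), (q, 6), (q, 7), entry b (Suc q), (q, 3), (q, 4)] ! p
     else
       if b q then
         [(q, 3), before b q, (q, 5), (q, 0),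
          (if hosts b q then (pr q, 7) else (q, 7)), (q, 2), entry b (Suc q),
          (if hosts b q then (pr q, 6) else (q, 4))] ! p
       else
         [before b q, (q, 2), (q, 1), (if hosts b q then (pr q, 6) else (q, 4)),
          (if hosts b q then (pr q, 7) else (q, 3)), (q, 6), (q, 5), entry b (Suc q)] ! p)"

text \<open>\<open>mate b v\<close> is the neighbour of \<open>v\<close> along the non-fixed edge in the path with bits \<open>b\<close>.\<close>

fun mate :: "(nat \<Rightarrow> bool) \<Rightarrow> nat \<times> nat \<Rightarrow> nat \<times> nat" where
  "mate b (q, p) =
    (if q = K then (if p = 0 then before b K else entry b 0) else inner_mate b q p)"

lemma flip_flip [simp]: "v \<in> cell_vertices \<Longrightarrow> flip (flip v) = v"
  by (cases v) (auto elim: oddE)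

lemma flip_mem [simp]: "v \<in> cell_vertices \<Longrightarrow> flip v \<in> cell_vertices"
  by (cases v) (auto simp: cell_vertices_def elim!: evenE)

lemma switch_vertex_cases [consumes 1, case_names sink source cell]:
  assumes "v \<in> switch_vertices"
  obtains "v = (K, 0)" | "v = (K, 1)" | q p where "v = (q, p)" "q < K" "p < 8"
  using assms unfolding switch_vertices_def cell_vertices_def by auto

lemma mate_entry: "q \<le> K \<Longrightarrow> mate b (entry b q) = before b q"
  by (auto simp: entry_def inner_mate_def)

lemma mate_exit: "q < K \<Longrightarrow> mate b (exit b q) = entry b (Suc q)"
  by (auto simp: exit_def inner_mate_def)

lemma mate_before: "q \<le> K \<Longrightarrow> mate b (before b q) = entry b q"
  by (auto simp: before_def mate_exit)

lemma mate_mate: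
  assumes "v \<in> switch_vertices"
  shows "mate b (mate b v) = v"
  using assms
proof (cases rule: switch_vertex_cases)
  case sink
  then have "v = entry b K" by (simp add: entry_def)
  then show ?thesis by (simp add: mate_entry mate_before)
next
  case source
  then have "v = before b 0" by (simp add: before_def)
  then show ?thesis by (simp add: mate_entry mate_before)
next
  case (cell q p)
  have "mate b (mate b (q, p)) = (q, p)" 
  \<comment> \<open>Entry and exit are linked to neighbouring cells, whose bits matter too; all
    other mates lie in \<open>q\<close> or \<open>pr q\<close> and are checked vertex by
    vertex.\<close>
  proof (cases "(q, p) = entry b q \<or> (q, p) = exit b q")
    case True
    then show ?thesis
    proof
      assume *: "(q, p) = entry b q"
      show ?thesis using cell(2) unfolding * by (simp add: mate_entry mate_before)
    next
      assume *: "(q, p) = exit b q"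
      have "mate b (entry b (Suc q)) = exit b q" using cell(2) by (simp add: mate_entry before_def)
      then show ?thesis using cell(2) unfolding * by (simp add: mate_exit)
    qed
  next
    case False
    from cell(3) show ?thesis 
      using False cell(2) pr_less[OF cell(2)] pr_pr[OF cell(2)] 
      by (cases p rule: less_8_cases)
         (auto simp: entry_def exit_def inner_mate_def hosts_def split: if_splits)
  qed
  then show ?thesis using cell by simp
qed

lemma mate_mem:
  assumes "v \<in> switch_vertices"
  shows "mate b v \<in> switch_vertices"
  using assms
proof (cases rule: switch_vertex_cases)
  case (cell q p)
  from cell(3) show ?thesis using cell(1,2) pr_less[OF cell(2)]
    by (cases p rule: less_8_cases)
       (auto simp: entry_def exit_def before_def inner_mate_def switch_vertices_def cell_vertices_def)
qed (auto simp: entry_def exit_def before_def switch_vertices_def cell_vertices_def)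

lemma mate_neq:
  assumes "v \<in> switch_vertices"
  shows "mate b v \<noteq> v"
  using assms
proof (cases rule: switch_vertex_cases)
  case (cell q p)
  from cell(3) show ?thesis using cell(1,2) pr_less[OF cell(2)]
    by (cases p rule: less_8_cases)
       (auto simp: entry_def exit_def before_def inner_mate_def hosts_def)
qed (auto simp: entry_def exit_def before_def)

lemma mate_neq_flip:
  assumes "v \<in> cell_vertices"
  shows "mate b v \<noteq> flip v"
proof -
  obtain q p where v: "v = (q, p)" and q: "q < K" and p: "p < 8"
    using assms unfolding cell_vertices_def by auto
  from p show ?thesis using q pr_less[OF q] unfolding v
    by (cases p rule: less_8_cases)
       (auto simp: entry_def exit_def before_def inner_mate_def hosts_def)
qed

lemma mate_upper_0:
  assumes "q < K" "q < pr q" "\<not> b q"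
  shows "mate b (q, 0) = before b q"
    and "mate b (q, Suc 0) = (q, 2)"
    and "mate b (q, 2) = (q, Suc 0)"
    and "mate b (q, 3) = (q, 6)"
    and "mate b (q, 4) = (q, 7)"
    and "mate b (q, 5) = entry b (Suc q)"
    and "mate b (q, 6) = (q, 3)"
    and "mate b (q, 7) = (q, 4)"
  using assms by (simp_all add: inner_mate_def)

lemma mate_upper_1:
  assumes "q < K" "q < pr q" "b q"
  shows "mate b (q, 0) = (q, 3)"
    and "mate b (q, Suc 0) = before b q"
    and "mate b (q, 2) = (q, 5)"
    and "mate b (q, 3) = (q, 0)"
    and "mate b (q, 4) = entry b (Suc q)"
    and "mate b (q, 5) = (q, 2)"
    and "mate b (q, 6) = (pr q, if b (pr q) then 7 else 3)"
    and "mate b (q, 7) = (pr q, 4)"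
  using assms by (simp_all add: inner_mate_def)

lemma mate_lower_0:
  assumes "q < K" "\<not> q < pr q" "\<not> b q"
  shows "mate b (q, 0) = before b q"
    and "mate b (q, Suc 0) = (q, 2)"
    and "mate b (q, 2) = (q, Suc 0)"
    and "mate b (q, 3) = (if hosts b q then (pr q, 6) else (q, 4))"
    and "mate b (q, 4) = (if hosts b q then (pr q, 7) else (q, 3))"
    and "mate b (q, 5) = (q, 6)"
    and "mate b (q, 6) = (q, 5)"
    and "mate b (q, 7) = entry b (Suc q)"
  using assms by (simp_all add: inner_mate_def)

lemma mate_lower_1:
  assumes "q < K" "\<not> q < pr q" "b q"
  shows "mate b (q, 0) = (q, 3)"
    and "mate b (q, Suc 0) = before b q"
    and "mate b (q, 2) = (q, 5)"
    and "mate b (q, 3) = (q, 0)"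
    and "mate b (q, 4) = (if hosts b q then (pr q, 7) else (q, 7))"
    and "mate b (q, 5) = (q, 2)"
    and "mate b (q, 6) = entry b (Suc q)"
    and "mate b (q, 7) = (if hosts b q then (pr q, 6) else (q, 4))"
  using assms by (simp_all add: inner_mate_def)

lemmas mate_table = mate_upper_0 mate_upper_1 mate_lower_0 mate_lower_1

text \<open>This shows that the fixed edges and mates form one path and not a path plus cycles: a
  property spreading along both kinds of edges is carried from the source through the cells in
  order.\<close>

lemma propagate:
  assumes source: "C (K, 1)"
    and mate: "\<And>v. v \<in> switch_vertices \<Longrightarrow> C v \<Longrightarrow> C (mate b v)"
    and flip: "\<And>v. v \<in> cell_vertices \<Longrightarrow> C v \<Longrightarrow> C (flip v)"
    and v: "v \<in> switch_vertices"
  shows "C v"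
proof -
  have M8: "C (q, p) \<Longrightarrow> C (mate b (q, p))" if "q < K" "p < 8" for q p
    using mate[of "(q, p)"] that by (simp add: switch_vertices_def cell_vertices_def del: mate.simps)
  have F: "C (q, p) \<Longrightarrow> C (flip (q, p))" if "q < K" "p < 8" for q p
    using flip[of "(q, p)"] that by (simp add: cell_vertices_def)
  have F': "C (q, 2*r) \<longleftrightarrow> C (q, Suc (2*r))" if "q < K" "r < 4" for q r
    using F[of q "2*r"] F[of q "Suc (2*r)"] that by auto
  have F8: "C (q, 0) \<longleftrightarrow> C (q, Suc 0)" "C (q, 2) \<longleftrightarrow> C (q, 3)" "C (q, 4) \<longleftrightarrow> C (q, 5)" "C (q, 6) \<longleftrightarrow> C (q, 7)"
    if "q < K" for q
    using F'[of q 0] F'[of q 1] F'[of q 2] F'[of q 3] that by (simp_all add: eval_nat_numeral)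
  \<comment> \<open>One passage from the entry of a cell to the entry of the next. It misses only
    the token of an upper cell in state 1, and picks up the token that the cell hosts.\<close>
  have through: "C (q, 0) \<and> C (q, 2) \<and> C (q, 4) \<and> (q < pr q \<and> b q \<or> C (q, 6)) \<and>
      (hosts b q \<longrightarrow> C (pr q, 6)) \<and> C (entry b (Suc q))" if q: "q < K" and en: "C (entry b q)" for q
  proof -
    have 0: "C (q, 0)"
      using en F8(1)[OF q] by (auto simp: entry_def split: if_splits)
    have M: "C (q, 0) \<Longrightarrow> C (mate b (q, 0))" "C (q, Suc 0) \<Longrightarrow> C (mate b (q, Suc 0))"
      "C (q, 2) \<Longrightarrow> C (mate b (q, 2))" "C (q, 3) \<Longrightarrow> C (mate b (q, 3))"
      "C (q, 4) \<Longrightarrow> C (mate b (q, 4))" "C (q, 5) \<Longrightarrow> C (mate b (q, 5))"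
      "C (q, 6) \<Longrightarrow> C (mate b (q, 6))" "C (q, 7) \<Longrightarrow> C (mate b (q, 7))"
      using M8[OF q] by (simp_all del: mate.simps)
    show ?thesis
    proof (cases "q < pr q")
      case up: True
      then have nh: "\<not> hosts b q" by (simp add: hosts_def)
      show ?thesis
      proof (cases "b q")
        case True
        show ?thesis using M[unfolded mate_upper_1[where b=b, OF q up True]] F8[OF q] 0 nh up True by blast
      next
        case False
        show ?thesis using M[unfolded mate_upper_0[where b=b, OF q up False]] F8[OF q] 0 nh by blast
      qed
    next
      case low: False
      note F = F8[OF q] F8[OF pr_less[OF q]]
      have H: "C (pr q, 6) \<Longrightarrow> b q \<Longrightarrow> C (q, 7)" "C (pr q, 7) \<Longrightarrow> C (q, 4)" if "hosts b q"
        using M8[of "pr q" 6] M8[of "pr q" 7] that pr_less[OF q] pr_pr[OF q]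
        by (simp_all add: hosts_def mate_table del: mate.simps)
      show ?thesis
      proof (cases "b q"; cases "hosts b q")
        assume b: "b q" and h: "hosts b q"
        show ?thesis using M[unfolded mate_lower_1[where b=b, OF q low b] if_P[OF h]] F H[OF h] b 0 low by blast
      next
        assume b: "b q" and h: "\<not> hosts b q"
        show ?thesis using M[unfolded mate_lower_1[where b=b, OF q low b] if_not_P[OF h]] F 0 low h by blast
      next
        assume b: "\<not> b q" and h: "hosts b q"
        show ?thesis using M[unfolded mate_lower_0[where b=b, OF q low b] if_P[OF h]] F H[OF h] b 0 low by blast
      next
        assume b: "\<not> b q" and h: "\<not> hosts b q"
        show ?thesis using M[unfolded mate_lower_0[where b=b, OF q low b] if_not_P[OF h]] F 0 low h by blast
      qed
    qed
  qed
  have entries: "q \<le> K \<Longrightarrow> C (entry b q)" for q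
  proof (induction q)
    case 0
    then show ?case using mate[OF _ source] by (simp add: switch_vertices_def)
  next
    case (Suc q)
    then show ?case using through[of q] by simp
  qed
  have even: "C (q, 0)" "C (q, 2)" "C (q, 4)" "C (q, 6)" if q: "q < K" for q
  proof -
    note t = through[OF q entries] 
    show "C (q, 0)" "C (q, 2)" "C (q, 4)" using t q by auto
    \<comment> \<open>A token missing from its own cell is reached on the passage through the
      transposed cell.\<close>
    show "C (q, 6)"
    proof (cases "q < pr q \<and> b q")
      case True
      then have "hosts b (pr q)" using pr_pr[OF q] by (simp add: hosts_def)
      then show ?thesis using through[OF pr_less[OF q] entries] pr_less[OF q] pr_pr[OF q] by simp
    next
      case False
      then show ?thesis using t q by auto
    qed
  qed
  from v show ?thesis
  proof (cases rule: switch_vertex_cases)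
    case sink
    then show ?thesis using entries[of K] by (simp add: entry_def)
  next
    case source
    then show ?thesis using assms(1) by simp
  next
    case (cell q p)
    from cell(3) show ?thesis using even[OF cell(2)] F8[OF cell(2)] unfolding cell(1)
      by (cases p rule: less_8_cases) auto
  qed
qed

end

section \<open>How the state of an intermediate tree spreads through the cells\<close>

text \<open>
  For a path \<open>z\<close> between those of \<open>b\<close> and \<open>b'\<close>, \<open>S v\<close> states that the edge from \<open>v\<close> to \<open>mate b v\<close> lies in \<open>z\<close>.
  Where the mates differ, exactly one of the two edges at \<open>v\<close> lies in \<open>z\<close>, so \<open>S\<close> is constant along alternating cycles.
\<close>

locale switching = cells +
  fixes b b' :: "nat \<Rightarrow> bool" and S :: "nat \<times> nat \<Rightarrow> bool"
  assumes alternating: "v \<in> switch_vertices \<Longrightarrow> mate b v \<noteq> mate b' v \<Longrightarrow>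
      S (mate b v) = S v \<and> S (mate b' v) = S v"
    and no_square: "v \<in> cell_vertices \<Longrightarrow> mate b v \<in> cell_vertices \<Longrightarrow>
      mate b' (flip v) = flip (mate b v) \<Longrightarrow> S v \<Longrightarrow> S (flip v)"
begin

text \<open>Exchanging the two paths negates \<open>S\<close>. This halves the case analyses below:
  the bit may be taken as 0 in \<open>b\<close> and 1 in \<open>b'\<close>. The square condition for
  the exchanged paths is the contrapositive of the original one, read at
  \<open>flip v\<close>.\<close>

lemma swap: "switching K pr b' b (\<lambda>v. \<not> S v)"
proof
  fix v 
  show "v \<in> switch_vertices \<Longrightarrow> mate b' v \<noteq> mate b v \<Longrightarrow>
      (\<not> S (mate b' v)) = (\<not> S v) \<and> (\<not> S (mate b v)) = (\<not> S v)"
    using alternating[of v] by auto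
next
  fix v assume v: "v \<in> cell_vertices" "mate b' v \<in> cell_vertices"
      "mate b (flip v) = flip (mate b' v)" "\<not> S v"
  have "S (flip v) \<Longrightarrow> S (flip (flip v))"
    using no_square[of "flip v"] v by (simp del: flip.simps mate.simps)
  then show "\<not> S (flip v)" using v by (auto simp del: flip.simps)
qed

lemma alternating_cell:
  assumes "q < K" "p < 8" "mate b (q, p) = v" "mate b' (q, p) = w" "v \<noteq> w"
  shows "S (q, p) = S v \<and> S (q, p) = S w"
  using alternating[of "(q, p)"] assms
  by (auto simp: switch_vertices_def cell_vertices_def simp del: mate.simps)

text \<open>
  Two consecutive links without a token in between: on each of them at most one of the state 0 and state 1
  edges is used, for otherwise they close up to a 4-cycle, so by the degrees exactly one is used.
\<close>

lemma entry_pin_aux: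
  assumes q: "q < K" and b: "\<not> b q" "b' q"
  shows "S (q, 0) = S (q, Suc 0)"
proof
  have m0: "mate b (q, 0) = before b q" and m1: "mate b' (q, Suc 0) = before b' q"
    using mate_entry[of q b] mate_entry[of q b'] q b by (simp_all add: entry_def del: mate.simps)
  show "S (q, Suc 0) \<Longrightarrow> S (q, 0)"
    using no_square[of "(q, Suc 0)"] q b
    by (cases "q < pr q") (simp_all add: mate_table cell_vertices_def del: mate.simps)
  assume S: "S (q, 0)"
  show "S (q, Suc 0)"
  \<comment> \<open>If both paths enter from the same vertex, that vertex alternates between
    \<open>(q, 0)\<close> and \<open>(q, Suc 0)\<close>. Otherwise they enter from the two ends of
    one fixed edge, and the incoming link could close up to a square.\<close>
  proof (cases "before b q = before b' q")
    case True
    then have "mate b (before b q) = (q, 0)" "mate b' (before b q) = (q, Suc 0)"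
      using mate_before[of q b] mate_before[of q b'] q b by (simp_all add: entry_def del: mate.simps)
    moreover have "before b q \<in> switch_vertices"
      using q by (auto simp: before_def exit_def switch_vertices_def cell_vertices_def)
    ultimately show ?thesis using alternating[of "before b q"] S by auto
  next
    case False
    then have "before b q \<in> cell_vertices" "before b' q = flip (before b q)"
      using q by (auto simp: before_def exit_def cell_vertices_def split: if_splits)
    then show ?thesis
      using no_square[of "(q, 0)"] S q m0 m1 by (simp add: cell_vertices_def del: mate.simps)
  qed
qed

lemma entry_pin:
  assumes "q < K" "b q \<noteq> b' q"
  shows "S (q, 0) = S (q, Suc 0)"
proof (cases "b q")
  case True
  then show ?thesis using switching.entry_pin_aux[OF swap, of q] assms by auto
next
  case False
  then show ?thesis using entry_pin_aux[of q] assms by auto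
qed

text \<open>Either both paths continue to the same vertex, which then alternates between the two
  exits, or the next cell differs as well and its \<open>entry_pin\<close> is carried back across
  the link.\<close>

lemma exit_pin:
  assumes q: "q < K" and b: "b q \<noteq> b' q"
  shows "S (exit b q) = S (exit b' q)"
proof (cases "entry b (Suc q) = entry b' (Suc q)")
  case True
  have m: "mate c (entry c (Suc q)) = exit c q" for c
    using mate_entry[of "Suc q" c] q by (simp add: before_def)
  have "entry b (Suc q) \<in> switch_vertices"
    using q by (auto simp: entry_def switch_vertices_def cell_vertices_def)
  moreover have "exit b q \<noteq> exit b' q" using b by (auto simp: exit_def)
  ultimately show ?thesis
    using alternating[of "entry b (Suc q)"] m[of b] m[of b'] True by auto
next
  case False
  then have q': "Suc q < K" "b (Suc q) \<noteq> b' (Suc q)"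
    by (auto simp: entry_def split: if_splits)
  have e: "exit c q \<in> switch_vertices" for c
    using q by (auto simp: exit_def switch_vertices_def cell_vertices_def)
  have ne: "mate c (exit c q) \<noteq> mate c' (exit c q)" if "c q \<noteq> c' q" for c c'
    using that q mate_exit[OF q, of c] by (cases "q < pr q"; cases "c q") 
      (auto simp: exit_def mate_table entry_def hosts_def simp del: mate.simps dest: pr_less)
  have "S (exit b q) = S (entry b (Suc q))" "S (exit b' q) = S (entry b' (Suc q))"
    using alternating[OF e[of b] ne[of b b', OF b]]
      alternating[OF e[of b'] ne[of b' b, OF b[symmetric], symmetric]] q
    by (auto simp: mate_exit simp del: mate.simps)
  then show ?thesis using entry_pin[OF q'] by (auto simp: entry_def split: if_splits)
qed

text \<open>Alternating edges give the groups \<open>1 2 5\<close>, \<open>0 3 6\<close> and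
  \<open>4 7\<close>; \<open>entry_pin\<close> joins the first two and \<open>exit_pin\<close> joins
  \<open>5\<close> with \<open>4\<close>.\<close>

lemma upper_cell_aux:
  assumes q: "q < K" "q < pr q" and b: "\<not> b q" "b' q" and p: "p < 8"
  shows "S (q, p) = S (q, 0)"
proof -
  note t = mate_upper_0[where b=b, OF q b(1)] mate_upper_1[where b=b', OF q b(2)]
  have "S (q, Suc 0) = S (q, 2)"
    using alternating_cell[OF q(1) _ t(2) t(10)] by (auto simp: before_def exit_def)
  moreover have "S (q, 0) = S (q, 3)"
    using alternating_cell[OF q(1) _ t(1) t(9)] by (auto simp: before_def exit_def)
  moreover have "S (q, 2) = S (q, 5)"
    using alternating_cell[OF q(1) _ t(3) t(11)] by auto
  moreover have "S (q, 3) = S (q, 6)"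
    using alternating_cell[OF q(1) _ t(4) t(12)] by auto
  moreover have "S (q, 4) = S (q, 7)"
    using alternating_cell[OF q(1) _ t(5) t(13)] by (auto simp: entry_def)
  moreover have "S (q, 5) = S (q, 4)"
    using exit_pin[of q] q b by (auto simp: exit_def)
  moreover have "S (q, 0) = S (q, Suc 0)"
    using entry_pin[of q] q b by auto
  ultimately show ?thesis by (cases rule: less_8_cases[OF p]) auto
qed

text \<open>Alternating edges give \<open>1 2 5 6\<close> and \<open>0 3\<close>, and the pins join
  \<open>0\<close> with \<open>1\<close> and \<open>6\<close> with \<open>7\<close>. Vertex
  \<open>4\<close> is exempt when both paths host the token there: then its mates agree and
  \<open>S\<close> carries no information about the state.\<close>

lemma lower_cell_aux:
  assumes q: "q < K" "\<not> q < pr q" and b: "\<not> b q" "b' q" and p: "p < 8"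
    and p4: "p \<noteq> 4 \<or> mate b (q, p) \<noteq> mate b' (q, p)"
  shows "S (q, p) = S (q, 0)"
proof -
  note t = mate_lower_0[where b=b, OF q b(1)] mate_lower_1[where b=b', OF q b(2)]
  have "S (q, Suc 0) = S (q, 2)"
    using alternating_cell[OF q(1) _ t(2) t(10)] by (auto simp: before_def exit_def)
  moreover have "S (q, 0) = S (q, 3)"
    using alternating_cell[OF q(1) _ t(1) t(9)] by (auto simp: before_def exit_def)
  moreover have "S (q, 2) = S (q, 5)"
    using alternating_cell[OF q(1) _ t(3) t(11)] by auto
  moreover have "S (q, 5) = S (q, 6)"
    using alternating_cell[OF q(1) _ t(6) t(14)] by auto
  moreover have "S (q, 6) = S (q, 7)"
    using exit_pin[of q] q b by (auto simp: exit_def)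
  moreover have "S (q, 0) = S (q, Suc 0)"
    using entry_pin[of q] q b by auto
  moreover have "S (q, 4) = S (q, 3) \<or> S (q, 4) = S (q, 7)" if "p = 4"
    using alternating_cell[OF q(1) _ t(5) t(13)] p4 that q
    by (auto simp: t simp del: mate.simps split: if_splits)
  ultimately show ?thesis by (cases rule: less_8_cases[OF p]) auto
qed

lemma cell_uniform:
  assumes q: "q < K" "b q \<noteq> b' q" and p: "p < 8"
    and p4: "q < pr q \<or> p \<noteq> 4 \<or> mate b (q, p) \<noteq> mate b' (q, p)"
  shows "S (q, p) = S (q, 0)"
proof (cases "b q"; cases "q < pr q")
  assume "b q" "q < pr q"
  then show ?thesis using switching.upper_cell_aux[OF swap, of q p] q p by auto
next
  assume "b q" "\<not> q < pr q"
  then show ?thesis using switching.lower_cell_aux[OF swap, of q p] q p p4 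
    by (auto simp del: mate.simps)
next
  assume "\<not> b q" "q < pr q"
  then show ?thesis using upper_cell_aux[of q p] q p by auto
next
  assume "\<not> b q" "\<not> q < pr q"
  then show ?thesis using lower_cell_aux[of q p] q p p4 by (auto simp del: mate.simps)
qed

lemma exit_uniform:
  assumes "q < K" "b q \<noteq> b' q"
  shows "S (exit b q) = S (q, 0)" "S (exit b' q) = S (q, 0)"
  using cell_uniform[OF assms, of 4] cell_uniform[OF assms, of 5] cell_uniform[OF assms, of 6]
    cell_uniform[OF assms, of 7] by (auto simp: exit_def simp del: mate.simps)

lemma next_cell_tied:
  assumes q: "Suc q < K" and b: "b q \<noteq> b' q" "b (Suc q) \<noteq> b' (Suc q)"
  shows "S (q, 0) = S (Suc q, 0)"
proof -
  have m: "mate b (entry b (Suc q)) = exit b q" 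
    using mate_entry[of "Suc q" b] q by (simp add: before_def)
  moreover have "mate b' (entry b (Suc q)) \<noteq> exit b q"
    using b(2) q by (cases "Suc q < pr (Suc q)"; cases "b (Suc q)")
      (auto simp: entry_def exit_def mate_table simp del: mate.simps)
  moreover have "entry b (Suc q) \<in> switch_vertices"
    using q by (auto simp: entry_def switch_vertices_def cell_vertices_def)
  ultimately have "S (exit b q) = S (entry b (Suc q))"
    using alternating[of "entry b (Suc q)"] by auto
  also have "\<dots> = S (Suc q, 0)"
    using entry_pin[OF q b(2)] by (auto simp: entry_def)
  finally show ?thesis using exit_uniform(1)[of q] q b by auto
qed

text \<open>The end \<open>6\<close> of the token is linked inside the upper cell in state 0 and to
  vertex \<open>3\<close> or \<open>7\<close> of the transposed cell in state 1. Where the bit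
  differs, \<open>S\<close> at \<open>6\<close> therefore agrees with \<open>S\<close> in both
  cells.\<close>

lemma partner_cell_tied:
  assumes q: "q < K" and b: "b q \<noteq> b' q" "b (pr q) \<noteq> b' (pr q)"
  shows "S (q, 0) = S (pr q, 0)"
proof -
  have up: "S (q, 0) = S (pr q, 0)"
    if q: "q < K" and up: "q < pr q" and b: "b q \<noteq> b' q" "b (pr q) \<noteq> b' (pr q)" for q
  proof -
    have "S (q, 6) = S (pr q, 3) \<or> S (q, 6) = S (pr q, 7)"
      using alternating_cell[OF q, of 6, OF _ refl refl] q up b
      by (cases "b q") (auto simp: mate_table simp del: mate.simps split: if_splits)
    moreover have "S (q, 6) = S (q, 0)" using q up b by (intro cell_uniform) auto
    moreover have "S (pr q, 3) = S (pr q, 0)" "S (pr q, 7) = S (pr q, 0)"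
      using cell_uniform[OF pr_less[OF q] b(2), of 3] cell_uniform[OF pr_less[OF q] b(2), of 7] by (auto simp del: mate.simps)
    ultimately show ?thesis by auto
  qed
  consider "q < pr q" | "q = pr q" | "pr q < q" by linarith
  then show ?thesis
  proof cases
    case 1 then show ?thesis using up[of q] q b by simp
  next
    case 2 then show ?thesis by simp
  next
    case 3 then show ?thesis using up[of "pr q"] q b pr_less[OF q] pr_pr[OF q] by simp
  qed
qed

text \<open>Mates may differ also in a cell with equal bits, next to a differing cell or at a token
  shared with one. Then some mate lies in a differing cell, or is the sink's or source's counterpart
  there, and the value of \<open>S\<close> is copied from it.\<close>

lemma switch_uniform:
  assumes D: "\<And>q. q < K \<Longrightarrow> b q \<noteq> b' q \<Longrightarrow> S (q, 0) = r"
    and v: "v \<in> switch_vertices" and diff: "mate b v \<noteq> mate b' v"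
  shows "S v = r"
proof -
  note alt = alternating[OF v diff]
  have ex: "S (exit b q) = r" if "q < K" "exit b q \<noteq> exit b' q" for q
  proof -
    have "b q \<noteq> b' q" using that(2) by (rule contrapos_nn) (simp add: exit_def)
    then show ?thesis using exit_uniform(1)[of q] D[of q] that(1) by auto
  qed
  have before: "S v = r" if "mate b v = before b q" "mate b' v = before b' q" "q \<le> K" for q
    using that diff alt ex[of "q - 1"] by (auto simp: before_def split: if_splits)
  have after: "S v = r" if "mate b v = entry b q" "mate b' v = entry b' q" for q
  proof -
    have "q < K" "b q \<noteq> b' q" using that diff by (auto simp: entry_def split: if_splits)
    then have "S (entry b q) = r" using D[of q] entry_pin[of q] by (auto simp: entry_def)
    then show ?thesis using alt that by auto
  qed
  from v show ?thesis
  proof (cases rule: switch_vertex_cases)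
    case sink
    then show ?thesis by (intro before[of K]) auto
  next
    case source
    then show ?thesis by (intro after[of 0]) auto
  next
    case (cell q p)
    show ?thesis
    proof (cases "b q = b' q")
      case False
      then show ?thesis using cell cell_uniform[of q p] D[of q] diff by (auto simp del: mate.simps)
    next
      case True
      have pq: "pr q < K" "pr (pr q) = q" using pr_less pr_pr cell(2) by auto
      consider "(q, p) = entry b q" | "(q, p) = exit b q" | "(q, p) \<noteq> entry b q" "(q, p) \<noteq> exit b q" by blast
      then show ?thesis
      proof cases
        case 1
        then have "mate b v = before b q" "mate b' v = before b' q"
          using mate_entry[of q b] mate_entry[of q b'] cell True by (auto simp: entry_def simp del: mate.simps)
        then show ?thesis using before[of q] cell by auto
      next
        case 2
        then have "mate b v = entry b (Suc q)" "mate b' v = entry b' (Suc q)"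
          using mate_exit[of q b] mate_exit[of q b'] cell True by (auto simp: exit_def simp del: mate.simps)
        then show ?thesis using after by auto
      next
        case 3
        have D': "b (pr q) \<noteq> b' (pr q)"
          using diff cell True 3
          by (cases "q < pr q"; cases "b q"; cases rule: less_8_cases[OF cell(3)])
             (auto simp: mate_table hosts_def entry_def exit_def simp del: mate.simps split: if_splits)
        have S': "S (pr q, p) = r" if "p \<in> {3, 6, 7}" for p
          using cell_uniform[of "pr q" p] pq D[of "pr q"] D' that by auto
        \<comment> \<open>The possible mates in \<open>pr q\<close> avoid vertex \<open>4\<close>,
          the exception in \<open>cell_uniform\<close>.\<close>
        have "\<exists>p' \<in> {3, 6, 7}. mate b v = (pr q, p') \<or> mate b' v = (pr q, p')"
          using diff cell True 3 D'
          by (cases "q < pr q"; cases "b q"; cases rule: less_8_cases[OF cell(3)])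
             (auto simp: mate_table hosts_def entry_def exit_def simp del: mate.simps split: if_splits)
        then obtain p' where p': "p' \<in> {3, 6, 7}" "mate b v = (pr q, p') \<or> mate b' v = (pr q, p')"
          by blast
        from p'(2) have "S v = S (pr q, p')" using alt by metis
        then show ?thesis using S'[OF p'(1)] by simp
      qed
    qed
  qed
qed

end

section \<open>The Hamiltonian paths\<close>

context cells
begin

definition path_vertices :: "nat \<Rightarrow> (nat \<times> nat) set" where
  "path_vertices L = cell_vertices \<union> {K} \<times> {..L} \<union> {(Suc K, 0)}"

text \<open>
  The vertices \<open>(K, 1), \<dots>, (K, L)\<close> form the initial segment, which absorbs all vertices that no cell needs;
  \<open>(K, L)\<close> and \<open>(Suc K, 0)\<close> are the ends of the path.
\<close>

fun fixed_nbrs :: "nat \<Rightarrow> nat \<times> nat \<Rightarrow> (nat \<times> nat) set" where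
  "fixed_nbrs L (q, p) =
    (if q < K then {flip (q, p)}
     else if q = K then
       (if p = 0 then {(Suc K, 0)}
        else (if p < L then {(K, Suc p)} else {}) \<union> (if 1 < p then {(K, p - 1)} else {}))
     else {(K, 0)})"

definition nbrs :: "nat \<Rightarrow> (nat \<Rightarrow> bool) \<Rightarrow> nat \<times> nat \<Rightarrow> (nat \<times> nat) set" where
  "nbrs L b v = fixed_nbrs L v \<union> (if v \<in> switch_vertices then {mate b v} else {})"

lemma fixed_nbrs_cell: "v \<in> cell_vertices \<Longrightarrow> fixed_nbrs L v = {flip v}"
  by (cases v) (auto simp: cell_vertices_def)

lemma flip_neq [simp]: "flip v \<noteq> v"
  by (cases v) (auto elim: oddE)

lemma path_vertex_cases [consumes 1, case_names cell sink chain last]: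
  assumes "v \<in> path_vertices L"
  obtains "v \<in> cell_vertices" | "v = (K, 0)" | p where "v = (K, p)" "1 \<le> p" "p \<le> L" | "v = (Suc K, 0)"
proof -
  have "v \<in> cell_vertices \<or> v = (K, 0) \<or> (\<exists>p. v = (K, p) \<and> 1 \<le> p \<and> p \<le> L) \<or> v = (Suc K, 0)"
    using assms unfolding path_vertices_def by (cases v; cases "snd v") auto
  then show ?thesis using that by blast
qed

lemma switch_iff: "(K, p) \<in> switch_vertices \<longleftrightarrow> p = 0 \<or> p = 1" "(Suc K, p) \<notin> switch_vertices"
  by (auto simp: switch_vertices_def cell_vertices_def)

lemma cell_switch: "v \<in> cell_vertices \<Longrightarrow> v \<in> switch_vertices"
  by (simp add: switch_vertices_def)

lemma switch_path_vertices: "1 \<le> L \<Longrightarrow> switch_vertices \<subseteq> path_vertices L"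
  by (auto simp: switch_vertices_def path_vertices_def)

lemma fixed_nbrs_sym:
  assumes "1 \<le> L" "v \<in> path_vertices L" "w \<in> fixed_nbrs L v"
  shows "w \<in> path_vertices L \<and> v \<in> fixed_nbrs L w \<and> w \<noteq> v"
  using assms(2)
proof (cases rule: path_vertex_cases)
  case cell
  then show ?thesis using assms(3) by (auto simp: fixed_nbrs_cell path_vertices_def simp del: flip.simps)
qed (use assms in \<open>auto simp: path_vertices_def split: if_splits\<close>)

lemma nbrs_sym:
  assumes "1 \<le> L" "v \<in> path_vertices L" "w \<in> nbrs L b v"
  shows "w \<in> path_vertices L \<and> v \<in> nbrs L b w \<and> w \<noteq> v"
proof (cases "w \<in> fixed_nbrs L v")
  case True
  then show ?thesis using fixed_nbrs_sym[OF assms(1,2)] by (auto simp: nbrs_def)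
next
  case False
  then have v: "v \<in> switch_vertices" and w: "w = mate b v"
    using assms(3) by (auto simp: nbrs_def split: if_splits)
  then show ?thesis
    using mate_mem[OF v] mate_mate[OF v] mate_neq[OF v] switch_path_vertices[OF assms(1)]
    by (auto simp: nbrs_def simp del: mate.simps)
qed

lemma mate_not_fixed:
  assumes "v \<in> switch_vertices"
  shows "mate b v \<notin> fixed_nbrs L v"
proof (cases "v \<in> cell_vertices")
  case True
  then show ?thesis using mate_neq_flip by (simp add: fixed_nbrs_cell del: mate.simps flip.simps)
next
  case False
  then have "v = (K, 0) \<or> v = (K, 1)" using assms by (auto simp: switch_vertices_def)
  then show ?thesis
    by (auto simp: before_def exit_def entry_def split: if_splits)
qed

text \<open>With \<open>L = 1\<close> the vertex \<open>(K, 1)\<close> would be an end of the path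
  and have no fixed edge.\<close>

lemma card_fixed_nbrs:
  assumes "2 \<le> L" "v \<in> switch_vertices"
  obtains h where "fixed_nbrs L v = {h}"
proof (cases "v \<in> cell_vertices")
  case True
  then show ?thesis using fixed_nbrs_cell that by blast
next
  case False
  then have "v = (K, 0) \<or> v = (K, 1)" using assms by (auto simp: switch_vertices_def)
  then show ?thesis using assms that by auto
qed

lemma card_nbrs:
  assumes L: "1 \<le> L" and v: "v \<in> path_vertices L"
  shows "card (nbrs L b v) = (if v = (K, L) \<or> v = (Suc K, 0) then 1 else 2)"
  using v
proof (cases rule: path_vertex_cases)
  case cell
  then have "v \<noteq> (K, L)" "v \<noteq> (Suc K, 0)" by (auto simp: cell_vertices_def)
  moreover have "nbrs L b v = {flip v, mate b v}"
    using cell cell_switch by (simp add: nbrs_def fixed_nbrs_cell insert_commute del: flip.simps mate.simps)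
  ultimately show ?thesis using mate_neq_flip[OF cell, of b] by (auto simp del: mate.simps flip.simps)
next
  case sink
  then show ?thesis using mate_not_fixed[of "(K, 0)" b L] L
    by (auto simp: nbrs_def switch_iff simp del: mate.simps)
next
  case (chain p)
  show ?thesis
  proof (cases "p = 1")
    case True
    then show ?thesis using mate_not_fixed[of "(K, 1)" b L] chain 
      by (auto simp: nbrs_def switch_iff simp del: mate.simps)
  next
    case False
    then show ?thesis using chain by (auto simp: nbrs_def switch_iff)
  qed
next
  case last
  then show ?thesis by (auto simp: nbrs_def switch_iff)
qed

end

section \<open>The paths as spanning trees on V\<close>

locale embedded_cells = cells +
  fixes L :: nat and g :: "nat \<times> nat \<Rightarrow> 'v::finite" and U :: "'v set"
  assumes L: "1 \<le> L" and bij: "bij_betw g (path_vertices L) UNIV"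
    and ends: "g (K, L) \<in> U" "g (Suc K, 0) \<in> U"
begin

definition path_edges :: "(nat \<Rightarrow> bool) \<Rightarrow> 'v set set" where
  "path_edges b = {{g v, g w} | v w. v \<in> path_vertices L \<and> w \<in> nbrs L b v}"

lemma g_eq_iff: "v \<in> path_vertices L \<Longrightarrow> w \<in> path_vertices L \<Longrightarrow> g v = g w \<longleftrightarrow> v = w"
  using bij by (auto simp: bij_betw_def inj_on_def)

lemma g_cases: obtains v where "v \<in> path_vertices L" "x = g v"
  using bij by (metis UNIV_I bij_betw_def imageE)

lemma path_edges_iff:
  assumes "v \<in> path_vertices L" "w \<in> path_vertices L"
  shows "{g v, g w} \<in> path_edges b \<longleftrightarrow> w \<in> nbrs L b v"
proof
  assume "{g v, g w} \<in> path_edges b"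
  then obtain v' w' where *: "{g v, g w} = {g v', g w'}" "v' \<in> path_vertices L" "w' \<in> nbrs L b v'"
    by (auto simp: path_edges_def)
  then have "w' \<in> path_vertices L \<and> v' \<in> nbrs L b w'" using nbrs_sym[OF L] by blast
  then show "w \<in> nbrs L b v" using * assms by (auto simp: doubleton_eq_iff g_eq_iff)
qed (use assms in \<open>unfold path_edges_def, blast\<close>)

lemma path_edges_subset: "path_edges b \<subseteq> Kn_edges"
proof
  fix e assume "e \<in> path_edges b"
  then obtain v w where *: "e = {g v, g w}" "v \<in> path_vertices L" "w \<in> nbrs L b v"
    by (auto simp: path_edges_def)
  then have "g v \<noteq> g w" using nbrs_sym[OF L] g_eq_iff by metis
  then show "e \<in> Kn_edges" using * by (simp add: Kn_edges_def)
qed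

lemma edges_at:
  assumes "Z \<subseteq> Kn_edges"
  shows "{e \<in> Z. g v \<in> e} = (\<lambda>w. {g v, g w}) ` {w \<in> path_vertices L. {g v, g w} \<in> Z}"
proof -
  have "\<exists>w\<in>path_vertices L. e = {g v, g w}" if e: "e \<in> Z" "g v \<in> e" for e
  proof -
    have "card e = 2" using e assms by (auto simp: Kn_edges_def)
    then obtain y where "e = {g v, y}" using e(2) by (metis card_2_iff doubleton_eq_iff insertE singletonD)
    then show ?thesis using g_cases[of y] by metis
  qed
  then show ?thesis by auto
qed

lemma degree_eq:
  assumes "Z \<subseteq> Kn_edges" "v \<in> path_vertices L"
  shows "degree Z (g v) = card {w \<in> path_vertices L. {g v, g w} \<in> Z}"
  unfolding degree_def edges_at[OF assms(1)]
  using assms(2) by (intro card_image) (auto simp: inj_on_def doubleton_eq_iff g_eq_iff)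

lemma degree_path_edges:
  assumes v: "v \<in> path_vertices L"
  shows "degree (path_edges b) (g v) = (if v = (K, L) \<or> v = (Suc K, 0) then 1 else 2)"
proof -
  have "{w \<in> path_vertices L. {g v, g w} \<in> path_edges b} = nbrs L b v"
    using path_edges_iff[OF v] nbrs_sym[OF L v] by auto
  then show ?thesis using degree_eq[OF path_edges_subset v] card_nbrs[OF L v] by simp
qed

lemma connected_path_edges: "connected_graph (path_edges b)"
proof -
  let ?R = "adj_in (path_edges b)"
  have sym: "symp ?R" by (auto simp: symp_def adj_in_def insert_commute)
  have step: "?R\<^sup>*\<^sup>* x (g w)" if "?R\<^sup>*\<^sup>* x (g v)" "v \<in> path_vertices L" "w \<in> nbrs L b v" for x v w
  proof -
    have "w \<in> path_vertices L" "w \<noteq> v" using nbrs_sym[OF L that(2,3)] by auto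
    then have "?R (g v) (g w)" using that path_edges_iff by (auto simp: adj_in_def g_eq_iff)
    then show ?thesis using that(1) by simp
  qed
  define C where "C v \<longleftrightarrow> ?R\<^sup>*\<^sup>* (g (K, 1)) (g v)" for v
  have stepC: "C w" if "C v" "v \<in> path_vertices L" "w \<in> nbrs L b v" for v w
    using step that unfolding C_def by blast
  have switch: "C v" if v: "v \<in> switch_vertices" for v
  proof (rule propagate[of C b, OF _ _ _ v])
    show "C (K, 1)" by (simp add: C_def)
    show "C (mate b v)" if "v \<in> switch_vertices" "C v" for v
      using that switch_path_vertices[OF L]
      by (rule_tac stepC[of v]) (auto simp: nbrs_def simp del: mate.simps)
    show "C (flip v)" if "v \<in> cell_vertices" "C v" for v
      using that
      by (rule_tac stepC[of v]) (auto simp: nbrs_def fixed_nbrs_cell path_vertices_def simp del: flip.simps)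
  qed
  have chain: "C (K, p)" if "1 \<le> p" "p \<le> L" for p
    using that
  proof (induction p rule: dec_induct)
    case base
    then show ?case by (simp add: C_def)
  next
    case (step p)
    then show ?case by (rule_tac stepC[of "(K, p)"]) (auto simp: nbrs_def path_vertices_def)
  qed
  have "C v" if "v \<in> path_vertices L" for v
    using that
  proof (cases rule: path_vertex_cases)
    case last
    have "C (K, 0)" by (rule switch) (simp add: switch_iff)
    then show ?thesis using last
      by (rule_tac stepC[of "(K, 0)"]) (auto simp: nbrs_def path_vertices_def)
  qed (use switch chain cell_switch in \<open>auto simp: switch_iff\<close>)
  then have reach: "?R\<^sup>*\<^sup>* (g (K, 1)) x" for x using g_cases[of x] unfolding C_def by metis
  have "?R\<^sup>*\<^sup>* x y" for x y
    using reach[of x] reach[of y] sympD[OF symp_rtranclp[OF sym]] by (meson rtranclp_trans)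
  then show ?thesis by (simp add: connected_graph_def)
qed

lemma tight_path_edges: "tight U (path_edges b)"
proof -
  have "acyclic_graph (path_edges b)"
  proof (rule acyclic_graphI[OF connected_path_edges])
    show "degree (path_edges b) x \<le> 2" for x
      using g_cases[of x] degree_path_edges[of _ b] by (metis le_refl one_le_numeral)
    show "degree (path_edges b) (g (Suc K, 0)) \<le> 1"
      by (simp add: degree_path_edges path_vertices_def)
  qed
  moreover have deg: "degree (path_edges b) x = 2" if x: "x \<notin> U" for x
  proof -
    obtain v where v: "v \<in> path_vertices L" "x = g v" by (rule g_cases)
    then show ?thesis using x ends degree_path_edges[OF v(1), of b] by auto
  qed
  moreover have "leaves (path_edges b) \<subseteq> U" using deg by (force simp: leaves_def)
  ultimately show ?thesis
    by (simp add: tight_def spanning_tree_def path_edges_subset connected_path_edges)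
qed

text \<open>The bit is read off the edge between vertices \<open>0\<close> and \<open>3\<close>,
  which occurs only in state 1.\<close>

lemma path_edges_inj:
  assumes "path_edges b = path_edges b'" "q < K"
  shows "b q = b' q"
proof -
  have v: "(q, 0) \<in> path_vertices L" "(q, 3) \<in> path_vertices L"
    using assms(2) by (auto simp: path_vertices_def cell_vertices_def)
  have "(q, 3) \<in> nbrs L c (q, 0) \<longleftrightarrow> c q" for c
    using assms(2) by (cases "q < pr q"; cases "c q")
     (auto simp: nbrs_def switch_vertices_def cell_vertices_def mate_table before_def exit_def simp del: mate.simps)
  then show ?thesis using path_edges_iff[OF v, of b] path_edges_iff[OF v, of b'] assms(1) by metis
qed

end

context embedded_cells
begin

lemma fixed_path_edges:
  "v \<in> path_vertices L \<Longrightarrow> w \<in> fixed_nbrs L v \<Longrightarrow> {g v, g w} \<in> path_edges b"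
  unfolding path_edges_def nbrs_def by blast

text \<open>The arrangement of the cells enters only through \<open>tied\<close>: the differing
  cells must be connected by ties. The switch vertices have to avoid \<open>U\<close> so that
  \<open>Z\<close> has degree exactly 2 at them.\<close>

lemma path_edges_between:
  assumes sw: "g ` switch_vertices \<subseteq> - U"
    and Z: "tight U Z" "path_edges b \<inter> path_edges b' \<subseteq> Z" "Z \<subseteq> path_edges b \<union> path_edges b'"
    and tied: "\<And>\<rho> :: nat \<Rightarrow> bool.
      (\<And>q. Suc q < K \<Longrightarrow> b q \<noteq> b' q \<Longrightarrow> b (Suc q) \<noteq> b' (Suc q) \<Longrightarrow> \<rho> q = \<rho> (Suc q)) \<Longrightarrow>
      (\<And>q. q < K \<Longrightarrow> b q \<noteq> b' q \<Longrightarrow> b (pr q) \<noteq> b' (pr q) \<Longrightarrow> \<rho> q = \<rho> (pr q)) \<Longrightarrow>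
      \<exists>r. \<forall>q<K. b q \<noteq> b' q \<longrightarrow> \<rho> q = r"
  shows "Z = path_edges b \<or> Z = path_edges b'"
proof -
  have "L \<noteq> 1" using sw ends(1) by (auto simp: switch_vertices_def)
  with L have L2: "2 \<le> L" by simp
  have pv: "v \<in> path_vertices L" if "v \<in> switch_vertices" for v
    using that switch_path_vertices[OF L] by blast
  have ZK: "Z \<subseteq> Kn_edges" using Z(1) by (simp add: tight_def spanning_tree_def)
  define N where "N v = {w \<in> path_vertices L. {g v, g w} \<in> Z}" for v
  have N_sym: "w \<in> N v \<longleftrightarrow> v \<in> N w" if "v \<in> path_vertices L" "w \<in> path_vertices L" for v w
    using that by (auto simp: N_def insert_commute)
  have N_fixed: "w \<in> N v" if "v \<in> path_vertices L" "w \<in> fixed_nbrs L v" for v w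
    using fixed_path_edges[OF that] fixed_nbrs_sym[OF L that] Z(2) by (auto simp: N_def)
  have N_card: "card (N v) = 2" if v: "v \<in> switch_vertices" for v
    using degree_eq[OF ZK pv[OF v]] sw v Z(1) by (auto simp: N_def tight_def)
  have N_sub: "w \<in> fixed_nbrs L v \<or> w = mate b v \<or> w = mate b' v"
    if "v \<in> switch_vertices" "w \<in> N v" for v w
  proof -
    have "w \<in> nbrs L b v \<union> nbrs L b' v"
      using that pv[of v] Z(3) path_edges_iff[of v w] by (auto simp: N_def)
    then show ?thesis by (auto simp: nbrs_def split: if_splits)
  qed
  have N_eq: "N v = {u, w}" if "v \<in> switch_vertices" "u \<in> N v" "w \<in> N v" "u \<noteq> w" for v u w
    using that N_card[of v] by (intro card_seteq[symmetric]) (auto intro: card_ge_0_finite)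
  have mate_both: "mate b v \<in> N v" if v: "v \<in> switch_vertices" and eq: "mate b v = mate b' v" for v
  proof -
    have "mate b v \<in> nbrs L b v \<inter> nbrs L b' v" using v eq by (auto simp: nbrs_def simp del: mate.simps)
    then show ?thesis using path_edges_iff[OF pv[OF v] pv[OF mate_mem[OF v, of b]]] Z(2) pv[OF mate_mem[OF v, of b]]
      by (auto simp: N_def simp del: mate.simps)
  qed
  define S where "S v \<longleftrightarrow> mate b v \<in> N v" for v
  \<comment> \<open>One of the two neighbours in \<open>Z\<close> is the fixed one, so exactly one
    of two distinct mates is left.\<close>
  have other: "mate b' v \<in> N v \<longleftrightarrow> \<not> S v" if v: "v \<in> switch_vertices" and ne: "mate b v \<noteq> mate b' v" for v
  proof -
    obtain h where h: "fixed_nbrs L v = {h}" using card_fixed_nbrs[OF L2 v] .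
    have hN: "h \<in> N v" using N_fixed[OF pv[OF v]] h by simp
    have hm: "h \<noteq> mate b v" "h \<noteq> mate b' v" using mate_not_fixed[OF v] h by auto
    show ?thesis
    proof
      assume "mate b' v \<in> N v"
      then have "N v = {h, mate b' v}" using N_eq[OF v hN] hm by blast
      then show "\<not> S v" using hm ne by (auto simp: S_def)
    next
      assume "\<not> S v"
      then have "N v \<subseteq> {h, mate b' v}" using N_sub[OF v] unfolding S_def h by blast
      moreover have "N v \<noteq> {h}" using N_card[OF v] by auto
      ultimately show "mate b' v \<in> N v" using hN by blast
    qed
  qed
  interpret switching K pr b b' S
  proof
    fix v assume v: "v \<in> switch_vertices" and ne: "mate b v \<noteq> mate b' v"
    let ?w = "mate b' v"
    have w: "?w \<in> switch_vertices" and ww: "mate b' ?w = v" using mate_mem[OF v] mate_mate[OF v] by auto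
    \<comment> \<open>Otherwise \<open>v\<close> would be the mate of \<open>?w\<close> in both
      paths, and the two mates of \<open>v\<close> would coincide.\<close>
    have "mate b ?w \<noteq> mate b' ?w" using mate_mate[OF w, of b] ww ne by metis
    then have "S ?w = S v" using other[OF w] other[OF v ne] N_sym[OF pv[OF v] pv[OF w]] ww by auto
    moreover have "S (mate b v) = S v"
      using N_sym[OF pv[OF v] pv[OF mate_mem[OF v, of b]]] mate_mate[OF v, of b]
      by (simp add: S_def del: mate.simps)
    ultimately show "S (mate b v) = S v \<and> S (mate b' v) = S v" by blast
  next
    fix v assume v: "v \<in> cell_vertices" and u: "mate b v \<in> cell_vertices"
      and eq: "mate b' (flip v) = flip (mate b v)" and Sv: "S v"
    let ?u = "mate b v"
    show "S (flip v)"
    \<comment> \<open>Otherwise both edges at each of \<open>v\<close>, \<open>flip v\<close>,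
      \<open>?u\<close>, \<open>flip ?u\<close> stay among these four vertices. As \<open>Z\<close>
      is connected, they would be all of V, but the sink is not a cell vertex.\<close>
    proof (rule ccontr)
      assume nS: "\<not> S (flip v)"
      note fv = flip_mem[OF v] and fu = flip_mem[OF u]
      note sv = cell_switch[OF v] and su = cell_switch[OF u] and sfv = cell_switch[OF fv] and sfu = cell_switch[OF fu]
      have flipN: "flip w \<in> N w" if "w \<in> cell_vertices" for w
        using N_fixed[OF pv[OF cell_switch[OF that]]] fixed_nbrs_cell[OF that] by simp
      have uv: "?u \<noteq> flip v" "flip ?u \<noteq> v" using mate_neq_flip[OF v, of b] flip_flip[OF u] by metis+
      have 1: "?u \<in> N v" using Sv by (simp add: S_def)
      have 2: "flip ?u \<in> N (flip v)"
        using mate_both[OF sfv] nS other[OF sfv] eq by (metis S_def)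
      have "N v = {flip v, ?u}" using N_eq[OF sv flipN[OF v] 1] uv by auto
      moreover have "N ?u = {flip ?u, v}" using N_eq[OF su flipN[OF u], of v] 1 N_sym[OF pv[OF sv] pv[OF su]] uv by auto
      moreover have "N (flip v) = {v, flip ?u}"
        using N_eq[OF sfv _ 2] flipN[OF fv] flip_flip[OF v] uv by auto
      moreover have "N (flip ?u) = {?u, flip v}"
        using N_eq[OF sfu, of ?u "flip v"] 2 N_sym[OF pv[OF sfv] pv[OF sfu]] flipN[OF fu] flip_flip[OF u] uv by auto
      ultimately have closed: "N w \<subseteq> {v, flip v, ?u, flip ?u}" if "w \<in> {v, flip v, ?u, flip ?u}" for w
        using that by (elim insertE) (simp_all del: mate.simps flip.simps)
      have "g ` {v, flip v, ?u, flip ?u} = UNIV"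
      proof (rule connected_graph_closed[of Z])
        show "connected_graph Z" using Z(1) by (simp add: tight_def spanning_tree_def)
        show "g v \<in> g ` {v, flip v, ?u, flip ?u}" by simp
        fix x y assume "x \<in> g ` {v, flip v, ?u, flip ?u}" and xy: "adj_in Z x y"
        then obtain w where w: "w \<in> {v, flip v, ?u, flip ?u}" "x = g w" by blast
        obtain w' where w': "w' \<in> path_vertices L" "y = g w'" by (rule g_cases)
        have "w' \<in> N w" using xy w w' by (simp add: N_def adj_in_def)
        then have "w' \<in> {v, flip v, ?u, flip ?u}" using closed[OF w(1)] by (rule subsetD[rotated])
        then show "y \<in> g ` {v, flip v, ?u, flip ?u}" unfolding w'(2) by (rule imageI)
      qed
      then have "g (K, 0) \<in> g ` {v, flip v, ?u, flip ?u}" by (metis UNIV_I)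
      then obtain w where w: "w \<in> {v, flip v, ?u, flip ?u}" "g (K, 0) = g w" by blast
      then have wc: "w \<in> cell_vertices" using v u fv fu by (elim insertE) simp_all
      have "(K, 0) = w" using w(2) g_eq_iff pv cell_switch[OF wc] by (metis switch_iff(1))
      then show False using wc by (auto simp: cell_vertices_def)
    qed
  qed
  obtain r where r: "\<forall>q<K. b q \<noteq> b' q \<longrightarrow> S (q, 0) = r"
    using tied[of "\<lambda>q. S (q, 0)"] next_cell_tied partner_cell_tied by blast
  have Sr: "S v = r" if "v \<in> switch_vertices" "mate b v \<noteq> mate b' v" for v
    using switch_uniform[of r v] r that by blast
  have edges: "e \<in> Z" if e: "e \<in> path_edges c" and c: "\<And>v. v \<in> switch_vertices \<Longrightarrow> mate c v \<in> N v" for e c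
  proof -
    obtain v w where vw: "e = {g v, g w}" "v \<in> path_vertices L" "w \<in> nbrs L c v"
      using e by (auto simp: path_edges_def)
    then have "w \<in> N v" using N_fixed[OF vw(2), of w] c[of v] by (auto simp: nbrs_def split: if_splits)
    then show ?thesis using vw by (simp add: N_def)
  qed
  have edges': "e \<in> path_edges c" if e: "e \<in> Z" "e \<in> path_edges c'"
    and c: "\<And>v. v \<in> switch_vertices \<Longrightarrow> mate c' v \<in> N v \<Longrightarrow> mate c' v = mate c v" for e c c'
  proof -
    obtain v w where vw: "e = {g v, g w}" "v \<in> path_vertices L" "w \<in> nbrs L c' v"
      using e(2) by (auto simp: path_edges_def)
    then have "w \<in> N v" using e(1) nbrs_sym[OF L vw(2,3)] by (simp add: N_def)
    then have "w \<in> nbrs L c v" using vw(3) c[of v] by (auto simp: nbrs_def split: if_splits)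
    then show ?thesis using vw unfolding path_edges_def by blast
  qed
  \<comment> \<open>Where the mates agree, the common edge is in \<open>Z\<close> anyway; where they
    differ, \<open>r\<close> selects the same path everywhere.\<close>
  show ?thesis
  proof (cases r)
    case True
    have m: "mate b v \<in> N v" if "v \<in> switch_vertices" for v
      using mate_both[OF that] Sr[OF that] True unfolding S_def by blast
    have m': "mate b' v = mate b v" if "v \<in> switch_vertices" "mate b' v \<in> N v" for v
      using other[OF that(1)] Sr[OF that(1)] True that(2) by (cases "mate b v = mate b' v") simp_all
    have "path_edges b \<subseteq> Z" using edges[OF _ m] by blast
    moreover have "Z \<subseteq> path_edges b" using Z(3) edges'[OF _ _ m'] by blast
    ultimately show ?thesis by blast
  next
    case False
    have m: "mate b' v \<in> N v" if "v \<in> switch_vertices" for v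
      using mate_both[OF that] other[OF that] Sr[OF that] False by (cases "mate b v = mate b' v") simp_all
    have m': "mate b v = mate b' v" if "v \<in> switch_vertices" "mate b v \<in> N v" for v
      using Sr[OF that(1)] False that(2) unfolding S_def by blast
    have "path_edges b' \<subseteq> Z" using edges[OF _ m] by blast
    moreover have "Z \<subseteq> path_edges b'" using Z(3) edges'[OF _ _ m'] by blast
    ultimately show ?thesis by blast
  qed
qed

end

text \<open>After \<open>J\<close> is placed off \<open>U\<close> and \<open>a\<close>,
  \<open>c\<close> at the prescribed points, the remaining sets have equal size, so any bijection
  between them completes \<open>g\<close>.\<close>

lemma ex_bij_betw_prescribed:
  fixes U :: "'v::finite set"
  assumes I: "finite I" "card I = CARD('v)" and J: "J \<subseteq> I" "card J \<le> card (- U)"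
    and a: "a \<in> I - J" "c \<in> I - J" "a \<noteq> c" and U: "u \<in> U" "w \<in> U" "u \<noteq> w"
  obtains g where "bij_betw g I UNIV" "g ` J \<subseteq> - U" "g a = u" "g c = w"
proof -
  obtain Y where Y: "Y \<subseteq> - U" "card Y = card J" by (meson J(2) obtain_subset_with_card_n)
  have fJ: "finite J" using I J finite_subset by blast
  obtain f where f: "bij_betw f J Y"
    using finite_same_card_bij[OF fJ _ Y(2)[symmetric]] by auto
  have "card (I - (J \<union> {a, c})) = card (UNIV - (Y \<union> {u, w}))"
  proof -
    have "card (J \<union> {a, c}) = card J + 2" using a fJ by simp
    moreover have "card (Y \<union> {u, w}) = card Y + 2" using U Y by (subst card_Un_disjoint) auto
    ultimately show ?thesis using I J a Y fJ by (subst (1 2) card_Diff_subset) auto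
  qed
  then obtain h where h: "bij_betw h (I - (J \<union> {a, c})) (UNIV - (Y \<union> {u, w}))"
    using finite_same_card_bij[of "I - (J \<union> {a, c})" "UNIV - (Y \<union> {u, w})"] I by auto
  define g where "g x = (if x \<in> J then f x else if x = a then u else if x = c then w else h x)" for x
  have "bij_betw g J Y" using f by (rule bij_betw_cong[THEN iffD1, rotated]) (simp add: g_def)
  moreover have "bij_betw g {a, c} {u, w}" using a U by (auto simp: bij_betw_def g_def inj_on_def)
  moreover have "bij_betw g (I - (J \<union> {a, c})) (UNIV - (Y \<union> {u, w}))"
    using h by (rule bij_betw_cong[THEN iffD1, rotated]) (auto simp: g_def)
  ultimately have "bij_betw g (J \<union> {a, c} \<union> (I - (J \<union> {a, c}))) (Y \<union> {u, w} \<union> (UNIV - (Y \<union> {u, w})))"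
    using Y U by (intro bij_betw_combine) auto
  moreover have "J \<union> {a, c} \<union> (I - (J \<union> {a, c})) = I" using J a by blast
  moreover have "Y \<union> {u, w} \<union> (UNIV - (Y \<union> {u, w})) = UNIV" by blast
  ultimately have "bij_betw g I UNIV" by simp
  moreover have "g ` J \<subseteq> - U" using f Y by (auto simp: g_def bij_betw_def)
  moreover have "g a = u" "g c = w" using a by (auto simp: g_def)
  ultimately show ?thesis using that by blast
qed

section \<open>The matrix of cells, numbered row by row\<close>

definition transposed :: "nat \<Rightarrow> nat \<Rightarrow> nat" where
  "transposed k q = (q mod k) * k + q div k"

lemma transposed_mult_add: "i < k \<Longrightarrow> j < k \<Longrightarrow> transposed k (i * k + j) = j * k + i"
  by (simp add: transposed_def)

lemma square_index:
  assumes "q < k * k"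
  obtains i j where "i < k" "j < k" "q = i * k + (j::nat)"
proof
  show "q div k < k" using assms by (simp add: less_mult_imp_div_less)
  show "q mod k < k" using assms by (cases "k = 0") auto
qed simp

lemma square_index_less: "i < k \<Longrightarrow> j < k \<Longrightarrow> i * k + j < k * (k::nat)"
  by (metis add.commute mult.commute mult_Suc_right Suc_leI le_trans mult_le_mono2 nat_add_left_cancel_less not_less_eq_eq not_le less_le_trans)

lemma cells_transposed: "cells (k * k) (transposed k)"
proof
  fix q assume "q < k * k"
  then obtain i j where "i < k" "j < k" "q = i * k + j" by (rule square_index)
  then show "transposed k q < k * k" "transposed k (transposed k q) = q"
    by (simp_all add: transposed_mult_add square_index_less)
qed

text \<open>Within a row consecutive cells are tied, and cells \<open>(i, j)\<close> and \<open>(j, i)\<close> tie rows \<open>i\<close> and \<open>j\<close>.\<close>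

lemma rows_tied:
  fixes k :: nat and x y :: "nat set" and \<rho> :: "nat \<Rightarrow> bool"
  defines "b \<equiv> \<lambda>q. q div k \<in> x" and "b' \<equiv> \<lambda>q. q div k \<in> y"
  assumes next_tied: "\<And>q. Suc q < k * k \<Longrightarrow> b q \<noteq> b' q \<Longrightarrow> b (Suc q) \<noteq> b' (Suc q) \<Longrightarrow> \<rho> q = \<rho> (Suc q)"
    and pr_tied: "\<And>q. q < k * k \<Longrightarrow> b q \<noteq> b' q \<Longrightarrow> b (transposed k q) \<noteq> b' (transposed k q) \<Longrightarrow>
      \<rho> q = \<rho> (transposed k q)"
  shows "\<exists>r. \<forall>q<k * k. b q \<noteq> b' q \<longrightarrow> \<rho> q = r"
proof -
  have D: "b (i * k + j) \<noteq> b' (i * k + j) \<longleftrightarrow> (i \<in> x) \<noteq> (i \<in> y)" if "j < k" for i j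
    using that by (simp add: b_def b'_def)
  have row: "\<rho> (i * k + j) = \<rho> (i * k)" if "i < k" "j < k" "(i \<in> x) \<noteq> (i \<in> y)" for i j
    using that(2)
  proof (induction j)
    case (Suc j)
    then show ?case using next_tied[of "i * k + j"] D[of j i] D[of "Suc j" i] that square_index_less[of i k "Suc j"]
      by auto
  qed simp
  have rows: "\<rho> (i * k) = \<rho> (j * k)"
    if "i < k" "j < k" "(i \<in> x) \<noteq> (i \<in> y)" "(j \<in> x) \<noteq> (j \<in> y)" for i j
    using pr_tied[of "i * k + j"] D[of j i] D[of i j] row[of i j] row[of j i] that
    by (simp add: transposed_mult_add square_index_less)
  show ?thesis
  proof (cases "\<exists>i<k. (i \<in> x) \<noteq> (i \<in> y)")
    case True
    then obtain i where i: "i < k" "(i \<in> x) \<noteq> (i \<in> y)" by blast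
    have "\<rho> q = \<rho> (i * k)" if q: "q < k * k" "b q \<noteq> b' q" for q
    proof -
      obtain i' j where ij: "i' < k" "j < k" "q = i' * k + j" using q(1) by (rule square_index)
      then show ?thesis using q(2) D[of j i'] row[of i' j] rows[of i' i] i by simp
    qed
    then show ?thesis by blast
  next
    case False
    have "b q = b' q" if q: "q < k * k" for q
    proof -
      obtain i' j where ij: "i' < k" "j < k" "q = i' * k + j" using q(1) by (rule square_index)
      then show ?thesis using D[of j i'] False by auto
    qed
    then show ?thesis by blast
  qed
qed

text \<open>Off \<open>U\<close> there must be room for eight vertices per cell together with
  \<open>(K, 0)\<close> and \<open>(K, 1)\<close>. For \<open>k = 0\<close> a single path suffices,
  and nothing has to avoid \<open>U\<close>.\<close>

lemma clique_number_SVMST_ge_power: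
  fixes U :: "'v::finite set"
  assumes U: "2 \<le> card U" and n: "card U < CARD('v)"
    and k: "k = 0 \<or> 8 * k\<^sup>2 + 2 \<le> CARD('v) - card U"
  shows "2 ^ k \<le> clique_number (SVMST U)"
proof -
  define K where "K = k * k"
  \<comment> \<open>Cells, the vertices \<open>(K, 0), ..., (K, L)\<close> and the last end make
    \<open>8 * K + L + 2\<close> vertices; \<open>L\<close> is chosen so that they exhaust
    V.\<close>
  define L where "L = CARD('v) - (8 * K + 2)"
  interpret cells K "transposed k" unfolding K_def by (rule cells_transposed)
  have n8: "8 * K + 3 \<le> CARD('v)" "k \<noteq> 0 \<Longrightarrow> 8 * K + 4 \<le> CARD('v)"
    using k U n by (auto simp: K_def power2_eq_square)
  have L: "1 \<le> L" "k \<noteq> 0 \<Longrightarrow> 2 \<le> L" using n8 by (auto simp: L_def)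
  have cv: "card cell_vertices = 8 * K" "finite cell_vertices" by (auto simp: cell_vertices_def)
  have card_sw: "card switch_vertices = 8 * K + 2"
    using cv unfolding switch_vertices_def
    by (subst card_insert_disjoint; auto simp: cell_vertices_def)+
  have card_pv: "card (path_vertices L) = CARD('v)" 
  proof -
    have "card (path_vertices L) = 8 * K + (L + 1) + 1"
      unfolding path_vertices_def using cv
      by (subst card_Un_disjoint; auto simp: cell_vertices_def)+
    then show ?thesis using n8(1) by (simp add: L_def)
  qed
  have fin_pv: "finite (path_vertices L)" using cv by (simp add: path_vertices_def)
  define J where "J = (if k = 0 then {} else switch_vertices)"
  obtain u w where uw: "u \<in> U" "w \<in> U" "u \<noteq> w"
    using U by (metis card_le_Suc0_iff_eq finite not_less_eq_eq numeral_2_eq_2)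
  have cJ: "card J \<le> card (- U)"
    using k card_sw by (auto simp: J_def K_def Compl_eq_Diff_UNIV card_Diff_subset power2_eq_square)
  have JI: "J \<subseteq> path_vertices L" "(K, L) \<in> path_vertices L - J" "(Suc K, 0) \<in> path_vertices L - J"
    using switch_path_vertices[OF L(1)] L by (auto simp: J_def switch_iff path_vertices_def)
  obtain g where g: "bij_betw g (path_vertices L) UNIV" "g ` J \<subseteq> - U" "g (K, L) = u" "g (Suc K, 0) = w"
    using ex_bij_betw_prescribed[OF fin_pv card_pv JI(1) cJ JI(2,3) _ uw] by auto
  interpret embedded_cells K "transposed k" L g U
    using L g uw by unfold_locales auto
  define T where "T x = path_edges (\<lambda>q. q div k \<in> x)" for x
  have inj: "inj_on T (Pow {..<k})"
  proof (rule inj_onI)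
    fix x y assume x: "x \<in> Pow {..<k}" and y: "y \<in> Pow {..<k}" and eq: "T x = T y"
    have "i \<in> x \<longleftrightarrow> i \<in> y" if "i < k" for i
      using path_edges_inj[OF eq[unfolded T_def], of "i * k"] that by (simp add: K_def)
    then show "x = y" using x y by blast
  qed
  have "card (T ` Pow {..<k}) \<le> clique_number (SVMST U)"
  proof (rule clique_number_SVMST_ge[OF U])
    show "tight U t" if "t \<in> T ` Pow {..<k}" for t using that tight_path_edges by (auto simp: T_def)
    fix s t z assume "s \<in> T ` Pow {..<k}" "t \<in> T ` Pow {..<k}" and ne: "s \<noteq> t"
      and z: "tight U z" "s \<inter> t \<subseteq> z" "z \<subseteq> s \<union> t"
    then obtain x y where xy: "x \<subseteq> {..<k}" "y \<subseteq> {..<k}" "s = T x" "t = T y" by auto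
    then have "k \<noteq> 0" using ne by auto
    then have sw: "g ` switch_vertices \<subseteq> - U" using g(2) by (simp add: J_def)
    show "z = s \<or> z = t"
      using path_edges_between[OF sw z[unfolded xy(3,4) T_def]] rows_tied[of k x y]
      unfolding xy(3,4) T_def K_def by blast
  qed
  then show ?thesis using inj by (simp add: card_image card_Pow)
qed

theorem theorem7:
  fixes U :: "'v::finite set"
  assumes "2 \<le> card U" and "card U \<le> CARD('v) - 1"
  shows "real (clique_number (SVMST U)) \<ge>
     2 powr ((sqrt (real_of_int \<lfloor>(real CARD('v) - real (card U) - 1) / 2\<rfloor>) - 9) / 2)"
proof -
  define s where "s = \<lfloor>(real CARD('v) - real (card U) - 1) / 2\<rfloor>"
  define e where "e = (sqrt (real_of_int s) - 9) / 2"
  \<comment> \<open>Rounding up gives at least the required power; a negative exponent gives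
    \<open>k = 0\<close>, where the bound is 1.\<close>
  define k where "k = nat \<lceil>e\<rceil>"
  have "0 < CARD('v)" by simp
  then have n: "card U < CARD('v)" using assms by linarith
  have "k = 0 \<or> 8 * k\<^sup>2 + 2 \<le> CARD('v) - card U"
  proof (cases "k = 0")
    case False
    then have "real k - 1 < e" unfolding k_def by linarith
    then have "2 * real k + 7 < sqrt (real_of_int s)" by (simp add: e_def)
    then have "(2 * real k + 7)\<^sup>2 < (sqrt (real_of_int s))\<^sup>2" by (intro power_strict_mono) auto
    moreover have "0 \<le> s" using n by (simp add: s_def)
    ultimately have "(2 * real k + 7)\<^sup>2 < real_of_int s" by simp
    also have "real_of_int s \<le> (real CARD('v) - real (card U) - 1) / 2" unfolding s_def by linarith
    finally have "2 * (2 * real k + 7)\<^sup>2 + 1 < real CARD('v) - real (card U)" by simp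
    \<comment> \<open>The leading terms agree, so the offset 9 in the exponent leaves ample room for
      rounding and the additive constants.\<close>
    moreover have "8 * (real k)\<^sup>2 + 1 \<le> 2 * (2 * real k + 7)\<^sup>2" 
      by (simp add: power2_eq_square algebra_simps)
    ultimately have "real (8 * k\<^sup>2 + 2) \<le> real (CARD('v) - card U)" using n by (simp add: of_nat_diff)
    then show ?thesis by linarith
  qed simp
  from clique_number_SVMST_ge_power[OF assms(1) n this]
  have "2 powr real k \<le> real (clique_number (SVMST U))"
    by (metis of_nat_le_iff of_nat_numeral of_nat_power powr_realpow zero_less_numeral)
  moreover have "2 powr e \<le> 2 powr real k"
    by (rule powr_mono) (simp_all add: k_def real_nat_ceiling_ge)
  ultimately show ?thesis unfolding e_def s_def by (rule order_trans[rotated])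
qed

end
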